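(* Let $B>0$ and let $\phi\in L^2(\mathbb{R})$ be such that $\mathcal{A}\phi(0,\omega)\neq0$ for every $\omega\in[-2B,2B]$. Then for all $f,g\in\mathrm{PW}^2_B$ the following are equivalent: (1) $f=e^{i\alpha}g$ for some $\alpha\in\mathbb{R}$; (2) $|\mathcal{V}_\phi f(x,\omega)|=|\mathcal{V}_\phi g(x,\omega)|$ for all $x,\omega\in\mathbb{R}$.
   Context: For $B>0$, the Paley--Wiener space is $\mathrm{PW}^2_B:=\{f:\mathbb{C}\to\mathbb{C} \mid \exists F\in L^2([-B,B])\ \forall z\in\mathbb{C}: f(z)=\int_{-B}^B F(\xi)e^{2\pi i \xi z}\,d\xi\}$; its elements are identified with their restrictions to $\mathbb{R}$ (which lie in $L^2(\mathbb{R})$) when transforms are applied. For $f,\phi\in L^2(\mathbb{R})$ the short-time Fourier transform is $\mathcal{V}_\phi f(x,\omega)=\int_{\mathbb{R}} f(t)\overline{\phi(t-x)}e^{-2\pi i t\omega}\,dt$, and the ambiguity function of $f\in L^2(\mathbb{R})$ is $\mathcal{A}f(x,\omega):=e^{\pi i x\omega}\mathcal{V}_f f(x,\omega)$, for $x,\omega\in\mathbb{R}$. *)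

theory Defs
  imports "HOL-Analysis.Analysis"
begin

definition L2_on :: "real set \<Rightarrow> (real \<Rightarrow> complex) \<Rightarrow> bool" where
  "L2_on S F \<longleftrightarrow> F \<in> borel_measurable (restrict_space lborel S)
      \<and> integrable (restrict_space lborel S) (\<lambda>t. (cmod (F t))\<^sup>2)"

abbreviation L2 :: "(real \<Rightarrow> complex) \<Rightarrow> bool" where
  "L2 F \<equiv> L2_on UNIV F"

definition PW :: "real \<Rightarrow> (complex \<Rightarrow> complex) set" where
  "PW B = {f. \<exists>F. L2_on {-B..B} F \<and>
      (\<forall>z. f z = (LINT \<xi>:{-B..B}|lborel. F \<xi> * exp (2 * pi * \<i> * complex_of_real \<xi> * z)))}"

definition STFT :: "(real \<Rightarrow> complex) \<Rightarrow> (real \<Rightarrow> complex) \<Rightarrow> real \<Rightarrow> real \<Rightarrow> complex" where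
  "STFT \<phi> f x \<omega> = (LINT t|lborel. f t * cnj (\<phi> (t - x)) * exp (- 2 * pi * \<i> * complex_of_real (t * \<omega>)))"

definition ambiguity :: "(real \<Rightarrow> complex) \<Rightarrow> real \<Rightarrow> real \<Rightarrow> complex" where
  "ambiguity f x \<omega> = exp (pi * \<i> * complex_of_real (x * \<omega>)) * STFT f f x \<omega>"

end

theory Submission
  imports Defs "HOL-Probability.Probability" "HOL-Complex_Analysis.Complex_Analysis"
    "HOL-Real_Asymp.Real_Asymp"
begin

text \<open>The phaseless data \<open>|V f(x, \<omega>)|\<^sup>2\<close> is, for fixed \<open>x\<close>, the Fourier transform of the
  autocorrelation of \<open>t \<mapsto> f(t) \<phi>(t - x)\<^sup>*\<close>. Read as a function of \<open>x\<close> at fixed lag \<open>s\<close>, that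
  autocorrelation is itself a correlation, of \<open>f(t) f(t - s)\<^sup>*\<close> with \<open>\<phi>(t) \<phi>(t - s)\<^sup>*\<close>; so the data
  determines the product of the Fourier transforms in \<open>t\<close> of these two functions. The
  transform of the first one is supported in \<open>[-2B, 2B]\<close>. The transform of the second one has no zero
  there for \<open>s = 0\<close> and, by continuity of translation in \<open>L\<^sup>2\<close> and compactness, for all \<open>|s| < d\<close>.
  Hence \<open>f(t) f(t - s)\<^sup>*\<close> is determined for all real \<open>t\<close> and all \<open>|s| < d\<close>. Near a real point where
  \<open>f\<close> does not vanish this determines \<open>f\<close> up to a unimodular constant, and \<open>f\<close> is entire.\<close>

subsection \<open>Continuity of translation\<close>

lemma L2_iff: "L2 v \<longleftrightarrow> v \<in> borel_measurable lborel \<and> integrable lborel (\<lambda>t. (cmod (v t))\<^sup>2)"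
  by (simp add: L2_on_def integrable_restrict_space set_integrable_def
      borel_measurable_restrict_space_iff)

lemma borel_measurable_translate:
  fixes v :: "real \<Rightarrow> 'a::topological_space"
  assumes [measurable]: "v \<in> borel_measurable borel"
  shows "(\<lambda>t. v (t - s)) \<in> borel_measurable borel"
  by measurable

lemma integrable_translate:
  fixes v :: "real \<Rightarrow> 'a::{banach, second_countable_topology}"
  assumes "integrable lborel v"
  shows "integrable lborel (\<lambda>t. v (t - s))"
  using lborel_integrable_real_affine[OF assms, of 1 "-s"] by simp

lemma integrable_reflect:
  fixes v :: "real \<Rightarrow> 'a::{banach, second_countable_topology}"
  assumes "integrable lborel v"
  shows "integrable lborel (\<lambda>t. v (s - t))"
  using lborel_integrable_real_affine[OF assms, of "-1" s] by simp

lemma integral_translate: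
  fixes v :: "real \<Rightarrow> 'a::{banach, second_countable_topology}"
  shows "(LINT t|lborel. v (t - s)) = (LINT t|lborel. v t)"
  using lborel_integral_real_affine[of 1 v "-s"] by simp

lemma L2_translate:
  assumes "L2 v"
  shows "L2 (\<lambda>t. v (t - s))"
  using assms integrable_translate[of "\<lambda>t. (cmod (v t))\<^sup>2" s] borel_measurable_translate[of v s]
  by (simp add: L2_iff)

lemma borel_measurable_cnj [measurable]: "cnj \<in> borel_measurable borel"
  by (intro borel_measurable_continuous_onI continuous_intros)

lemma borel_measurable_cis [measurable]: "cis \<in> borel_measurable borel"
  by (intro borel_measurable_continuous_onI continuous_intros)

lemma L2_cnj: "L2 v \<Longrightarrow> L2 (\<lambda>t. cnj (v t))"
  using measurable_comp[of v lborel borel cnj borel]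
  by (simp add: L2_iff o_def borel_measurable_cnj)

lemma integrable_L2_mult:
  assumes "L2 u" "L2 v"
  shows "integrable lborel (\<lambda>t. u t * v t)"
proof -
  have [measurable]: "u \<in> borel_measurable borel" "v \<in> borel_measurable borel"
    using assms by (auto simp: L2_iff)
  show ?thesis
  proof (rule Bochner_Integration.integrable_bound[where f = "\<lambda>t. (cmod (u t))\<^sup>2 + (cmod (v t))\<^sup>2"])
    show "AE t in lborel. cmod (u t * v t) \<le> norm ((cmod (u t))\<^sup>2 + (cmod (v t))\<^sup>2)"
    proof (intro AE_I2)
      fix t
      have "cmod (u t) * cmod (v t) \<le> (cmod (u t))\<^sup>2 + (cmod (v t))\<^sup>2"
        using sum_squares_bound[of "cmod (u t)" "cmod (v t)"]
          mult_nonneg_nonneg[of "cmod (u t)" "cmod (v t)"] by (simp del: mult_nonneg_nonneg)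
      then show "cmod (u t * v t) \<le> norm ((cmod (u t))\<^sup>2 + (cmod (v t))\<^sup>2)"
        by (simp add: norm_mult)
    qed
  qed (use assms in \<open>auto simp: L2_iff\<close>)
qed

text \<open>Serves the windowed products \<open>u t * cnj (\<phi> (t - x))\<close> later on: the
  window lies in L2 and \<open>u\<close> is bounded.\<close>

lemma L2_bounded_mult:
  assumes "L2 v" and [measurable]: "h \<in> borel_measurable borel" and b: "\<And>t. cmod (h t) \<le> M"
  shows "L2 (\<lambda>t. h t * v t)"
proof -
  have [measurable]: "v \<in> borel_measurable borel"
    using assms by (auto simp: L2_iff)
  have "integrable lborel (\<lambda>t. (cmod (h t * v t))\<^sup>2)"
  proof (rule Bochner_Integration.integrable_bound[where f = "\<lambda>t. M\<^sup>2 * (cmod (v t))\<^sup>2"])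
    show "AE t in lborel. norm ((cmod (h t * v t))\<^sup>2) \<le> norm (M\<^sup>2 * (cmod (v t))\<^sup>2)"
      using b by (intro AE_I2) (auto simp: norm_mult power_mult_distrib intro!: mult_right_mono power_mono)
  qed (use assms in \<open>auto simp: L2_iff\<close>)
  then show ?thesis
    by (simp add: L2_iff)
qed

section \<open>Continuity of translation in L1\<close>

text \<open>The positive part of \<open>indicat_real U t - indicat_real U (t - s)\<close> tends to 0
  pointwise because \<open>U\<close> is open, and it is dominated by \<open>indicat_real U\<close>.
  The negative part may fail to converge at boundary points, but translation preserves measure, so
  it has the same integral.\<close>

lemma open_translate_tendsto:
  fixes U :: "real set"
  assumes "open U" "emeasure lborel U < \<infinity>"
  shows "((\<lambda>s. LINT t|lborel. \<bar>indicat_real U (t - s) - indicat_real U t\<bar>) \<longlongrightarrow> 0) (at 0)"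
proof (rule tendsto_at_iff_sequentially[THEN iffD2], intro allI impI)
  fix X :: "nat \<Rightarrow> real"
  assume X: "X \<longlonglongrightarrow> 0"
  have [measurable]: "U \<in> sets borel"
    using assms by simp
  have iU: "integrable lborel (indicat_real U)"
    using assms by (intro integrable_real_indicator) auto
  have iU': "integrable lborel (\<lambda>t. indicat_real U (t - s))" for s
    using integrable_translate[OF iU] .
  have "(\<lambda>n. LINT t|lborel. max 0 (indicat_real U t - indicat_real U (t - X n))) \<longlonglongrightarrow> (LINT t::real|lborel. 0)"
  proof (rule integral_dominated_convergence[where w = "indicat_real U"])
    show "AE t in lborel. (\<lambda>n. max 0 (indicat_real U t - indicat_real U (t - X n))) \<longlonglongrightarrow> 0"
    proof (intro AE_I2)
      fix t
      show "(\<lambda>n. max 0 (indicat_real U t - indicat_real U (t - X n))) \<longlonglongrightarrow> 0"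
      proof (cases "t \<in> U")
        case True
        have "(\<lambda>n. t - X n) \<longlonglongrightarrow> t"
          using tendsto_diff[OF tendsto_const X, of t] by simp
        then have "eventually (\<lambda>n. t - X n \<in> U) sequentially"
          using True assms(1) by (auto dest: topological_tendstoD)
        then show ?thesis
          using True by (intro tendsto_eventually) (auto elim!: eventually_mono)
      qed (auto intro!: tendsto_eventually split: split_indicator)
    qed
  qed (use iU in \<open>auto split: split_indicator\<close>)
  \<comment> \<open>For the difference d of the two indicators, |d| = 2 max(0, -d) + d, and d
    integrates to 0.\<close>
  moreover have "(LINT t|lborel. \<bar>indicat_real U (t - s) - indicat_real U t\<bar>)
      = 2 * (LINT t|lborel. max 0 (indicat_real U t - indicat_real U (t - s)))" for s
  proof -
    have "(LINT t|lborel. \<bar>indicat_real U (t - s) - indicat_real U t\<bar>)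
      = (LINT t|lborel. 2 * max 0 (indicat_real U t - indicat_real U (t - s))
          + (indicat_real U (t - s) - indicat_real U t))"
      by (intro Bochner_Integration.integral_cong) (auto split: split_indicator)
    also have "\<dots> = (LINT t|lborel. 2 * max 0 (indicat_real U t - indicat_real U (t - s)))
        + ((LINT t|lborel. indicat_real U (t - s)) - (LINT t|lborel. indicat_real U t))"
      using iU iU'[of s]
      by (subst Bochner_Integration.integral_add)
         (auto intro!: integrable_max Bochner_Integration.integrable_diff simp del: integral_indicator)
    also have "(LINT t|lborel. indicat_real U (t - s)) = (LINT t|lborel. indicat_real U t)"
      by (rule integral_translate)
    finally show ?thesis
      by simp
  qed
  ultimately show "((\<lambda>s. LINT t|lborel. \<bar>indicat_real U (t - s) - indicat_real U t\<bar>) \<circ> X) \<longlonglongrightarrow> 0"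
    by (auto simp: o_def intro!: tendsto_mult_right_zero)
qed

text \<open>Triangle inequality through \<open>v\<close>: the error \<open>u - v\<close> enters
  twice, once translated, with the same integral both times.\<close>

lemma translate_L1_diff_bound:
  fixes u v :: "real \<Rightarrow> 'a::{banach, second_countable_topology}"
  assumes u: "integrable lborel u" and v: "integrable lborel v"
  shows "(LINT t|lborel. norm (u (t - s) - u t))
      \<le> (LINT t|lborel. norm (v (t - s) - v t)) + 2 * (LINT t|lborel. norm (u t - v t))"
proof -
  note us = integrable_translate[OF u, of s] and vs = integrable_translate[OF v, of s]
  have w: "integrable lborel (\<lambda>t. norm (u t - v t))"
    using u v by simp
  have "(LINT t|lborel. norm (u (t - s) - u t))
      \<le> (LINT t|lborel. norm (v (t - s) - v t) + norm (u (t - s) - v (t - s)) + norm (u t - v t))"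
  proof (rule integral_mono)
    show "norm (u (t - s) - u t)
        \<le> norm (v (t - s) - v t) + norm (u (t - s) - v (t - s)) + norm (u t - v t)" for t
      by norm
  qed (use u v us vs in auto)
  also have "\<dots> = (LINT t|lborel. norm (v (t - s) - v t))
      + (LINT t|lborel. norm (u (t - s) - v (t - s))) + (LINT t|lborel. norm (u t - v t))"
    using u v us vs by simp
  also have "(LINT t|lborel. norm (u (t - s) - v (t - s))) = (LINT t|lborel. norm (u t - v t))"
    by (rule integral_translate[of "\<lambda>t. norm (u t - v t)"])
  finally show ?thesis
    by simp
qed

text \<open>Continuity of translation passes to L1 limits: an approximation within e / 4 costs at
  most e / 2 for all shifts at once.\<close>

lemma translate_L1_approx:
  fixes u :: "real \<Rightarrow> 'a::{banach, second_countable_topology}"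
  assumes u: "integrable lborel u"
    and ap: "\<And>e. e > 0 \<Longrightarrow> \<exists>v. integrable lborel v \<and> (LINT t|lborel. norm (u t - v t)) < e
      \<and> ((\<lambda>s. LINT t|lborel. norm (v (t - s) - v t)) \<longlongrightarrow> 0) (at 0)"
  shows "((\<lambda>s. LINT t|lborel. norm (u (t - s) - u t)) \<longlongrightarrow> 0) (at 0)"
proof (rule tendstoI)
  fix e :: real
  assume "e > 0"
  then obtain v where v: "integrable lborel v" "(LINT t|lborel. norm (u t - v t)) < e / 4"
    and lim: "((\<lambda>s. LINT t|lborel. norm (v (t - s) - v t)) \<longlongrightarrow> 0) (at 0)"
    using ap[of "e / 4"] by auto
  have "eventually (\<lambda>s. dist (LINT t|lborel. norm (v (t - s) - v t)) 0 < e / 2) (at 0)"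
    using lim \<open>e > 0\<close> by (intro tendstoD) auto
  then show "eventually (\<lambda>s. dist (LINT t|lborel. norm (u (t - s) - u t)) 0 < e) (at 0)"
  proof eventually_elim
    case (elim s)
    then show ?case
      using translate_L1_diff_bound[OF u v(1), of s] v(2) by (simp add: abs_less_iff)
  qed
qed

text \<open>Induction over integrable functions: indicators are approximated from outside by open
  sets, sums follow from the triangle inequality, and limits from
  \<open>translate_L1_approx\<close>.\<close>

lemma translate_L1_tendsto:
  fixes u :: "real \<Rightarrow> 'a::{banach, second_countable_topology}"
  assumes "integrable lborel u"
  shows "((\<lambda>s. LINT t|lborel. norm (u (t - s) - u t)) \<longlongrightarrow> 0) (at 0)"
  using assms
proof (induction rule: integrable_induct)
  case (base A c)
  have [measurable]: "A \<in> sets borel" using base by simp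
  have iA: "integrable lborel (indicat_real A)"
    using base by (intro integrable_real_indicator) auto
  have *: "((\<lambda>s. LINT t|lborel. norm (indicat_real A (t - s) - indicat_real A t)) \<longlongrightarrow> 0) (at 0)"
  proof (rule translate_L1_approx[OF iA])
    fix e :: real
    assume e: "e > 0"
    have "A \<in> sets lebesgue"
      using base by simp
    \<comment> \<open>Outer regularity trades the measurable set for an open superset, to which
      \<open>open_translate_tendsto\<close> applies.\<close>
    from sets_lebesgue_outer_open[OF this e] obtain T
      where T: "open T" "A \<subseteq> T" "(T - A) \<in> lmeasurable" "emeasure lebesgue (T - A) < ennreal e" .
    have [measurable]: "T \<in> sets borel" using T by simp
    have Te: "emeasure lborel (T - A) < ennreal e"
      using T(4) by simp
    have fT: "emeasure lborel T < \<infinity>"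
    proof -
      have "emeasure lborel T \<le> emeasure lborel A + emeasure lborel (T - A)"
        using emeasure_subadditive[of A lborel "T - A"] T(2) by (simp add: Un_absorb1)
      also have "\<dots> < \<infinity>"
        using base(2) Te by (auto simp: less_top[symmetric] ennreal_add_eq_top)
      finally show ?thesis .
    qed
    have "(LINT t|lborel. norm (indicat_real A t - indicat_real T t)) = (LINT t|lborel. indicat_real (T - A) t)"
      using T(2) by (intro Bochner_Integration.integral_cong) (auto split: split_indicator)
    also have "\<dots> = measure lborel (T - A)"
      by simp
    also have "\<dots> < e"
      using Te e
      by (metis Sigma_Algebra.measure_def enn2real_ennreal enn2real_less_iff ennreal_less_top
          less_imp_le order_less_trans)
    finally show "\<exists>v. integrable lborel v \<and> (LINT t|lborel. norm (indicat_real A t - v t)) < e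
      \<and> ((\<lambda>s. LINT t|lborel. norm (v (t - s) - v t)) \<longlongrightarrow> 0) (at 0)"
      using open_translate_tendsto[OF T(1) fT] fT
      by (intro exI[of _ "indicat_real T"] conjI) auto
  qed
  have "norm (indicat_real A (t - s) *\<^sub>R c - indicat_real A t *\<^sub>R c)
      = norm (indicat_real A (t - s) - indicat_real A t) * norm c" for t s
    by (simp flip: scaleR_diff_left)
  then show ?case
    using tendsto_mult_left_zero[OF *, of "norm c"] by simp
next
  case (add f g)
  show ?case
  proof (rule tendsto_sandwich[OF _ _ tendsto_const])
    show "eventually (\<lambda>s. (LINT t|lborel. norm ((f (t - s) + g (t - s)) - (f t + g t)))
        \<le> (LINT t|lborel. norm (f (t - s) - f t)) + (LINT t|lborel. norm (g (t - s) - g t))) (at 0)"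
    proof (intro always_eventually allI)
      fix s
      note [simp] = integrable_translate[OF add(1), of s] integrable_translate[OF add(2), of s] add(1,2)
      have "(LINT t|lborel. norm ((f (t - s) + g (t - s)) - (f t + g t)))
          \<le> (LINT t|lborel. norm (f (t - s) - f t) + norm (g (t - s) - g t))"
        by (intro integral_mono) (auto intro: norm_diff_triangle_ineq)
      then show "(LINT t|lborel. norm ((f (t - s) + g (t - s)) - (f t + g t)))
        \<le> (LINT t|lborel. norm (f (t - s) - f t)) + (LINT t|lborel. norm (g (t - s) - g t))"
        by simp
    qed
    show "((\<lambda>s. (LINT t|lborel. norm (f (t - s) - f t)) + (LINT t|lborel. norm (g (t - s) - g t))) \<longlongrightarrow> 0) (at 0)"
      using tendsto_add[OF add(3,4)] by simp
  qed (auto intro!: always_eventually)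
next
  case (lim f s)
  have "(\<lambda>n. LINT t|lborel. norm (f t - s n t)) \<longlonglongrightarrow> (LINT t::real|lborel. 0)"
  \<comment> \<open>The factor 3 is 1 + 2: the induction rule supplies approximants with
    \<open>norm (s n t) \<le> 2 * norm (f t)\<close>.\<close>
  proof (rule integral_dominated_convergence[where w = "\<lambda>t. 3 * norm (f t)"])
    show "AE t in lborel. (\<lambda>n. norm (f t - s n t)) \<longlonglongrightarrow> 0"
    proof (intro AE_I2)
      fix t
      have "(\<lambda>n. s n t) \<longlonglongrightarrow> f t" using lim by simp
      then have "(\<lambda>n. f t - s n t) \<longlonglongrightarrow> f t - f t" by (intro tendsto_intros)
      then show "(\<lambda>n. norm (f t - s n t)) \<longlonglongrightarrow> 0"
        using tendsto_norm by force
    qed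
    show "AE t in lborel. norm (norm (f t - s n t)) \<le> 3 * norm (f t)" for n
    proof (intro AE_I2)
      fix t
      have "norm (s n t) \<le> 2 * norm (f t)" using lim by simp
      then show "norm (norm (f t - s n t)) \<le> 3 * norm (f t)"
        using norm_triangle_ineq4[of "f t" "s n t"] by simp
    qed
  qed (use lim in auto)
  then have 0: "(\<lambda>n. LINT t|lborel. norm (f t - s n t)) \<longlonglongrightarrow> 0"
    by simp
  show ?case
  proof (rule translate_L1_approx)
    fix e :: real
    assume "e > 0"
    then obtain n where "(LINT t|lborel. norm (f t - s n t)) < e"
      using order_tendstoD(2)[OF 0] eventually_happens'[OF sequentially_bot] by blast
    then show "\<exists>v. integrable lborel v \<and> (LINT t|lborel. norm (f t - v t)) < e
      \<and> ((\<lambda>s. LINT t|lborel. norm (v (t - s) - v t)) \<longlongrightarrow> 0) (at 0)"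
      using lim by (intro exI[of _ "s n"]) auto
  qed (use lim in auto)
qed

section \<open>Continuity of translation in L2\<close>

lemma L2_power2_diff:
  assumes "L2 u" "L2 v"
  shows "integrable lborel (\<lambda>t. (cmod (u t - v t))\<^sup>2)"
proof (rule Bochner_Integration.integrable_bound[where f = "\<lambda>t. 2 * (cmod (u t))\<^sup>2 + 2 * (cmod (v t))\<^sup>2"])
  show "AE t in lborel. norm ((cmod (u t - v t))\<^sup>2) \<le> norm (2 * (cmod (u t))\<^sup>2 + 2 * (cmod (v t))\<^sup>2)"
  proof (intro AE_I2)
    fix t
    have "(cmod (u t - v t))\<^sup>2 \<le> (cmod (u t) + cmod (v t))\<^sup>2"
      by (intro power_mono norm_triangle_ineq4) auto
    also have "\<dots> \<le> 2 * (cmod (u t))\<^sup>2 + 2 * (cmod (v t))\<^sup>2"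
      using sum_squares_bound[of "cmod (u t)" "cmod (v t)"] by (simp add: power2_sum)
    finally show "norm ((cmod (u t - v t))\<^sup>2) \<le> norm (2 * (cmod (u t))\<^sup>2 + 2 * (cmod (v t))\<^sup>2)"
      by simp
  qed
qed (use assms in \<open>auto simp: L2_iff\<close>)

lemma L2_diff: "L2 u \<Longrightarrow> L2 v \<Longrightarrow> L2 (\<lambda>t. u t - v t)"
  using L2_power2_diff[of u v] by (auto simp: L2_iff)

text \<open>Truncate \<open>v\<close> to 0 where its modulus is below \<open>1 / Suc n\<close> or
  above \<open>Suc n\<close>. The upper cut makes the truncation bounded; the lower one makes it
  integrable, since there |v| is at most \<open>Suc n\<close> times its square. Every nonzero value
  is eventually kept, so dominated convergence gives the approximation.\<close>

lemma L2_bounded_approx: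
  assumes v: "L2 v" and "e > 0"
  obtains a M where "integrable lborel a" "L2 a" "\<And>t. cmod (a t) \<le> M"
    "(LINT t|lborel. (cmod (v t - a t))\<^sup>2) < e"
proof -
  have [measurable]: "v \<in> borel_measurable borel" and iv: "integrable lborel (\<lambda>t. (cmod (v t))\<^sup>2)"
    using v by (auto simp: L2_iff)
  define a where "a n t = (if 1 / Suc n \<le> cmod (v t) \<and> cmod (v t) \<le> Suc n then v t else 0)"
    for n :: nat and t
  have a_meas [measurable]: "a n \<in> borel_measurable borel" for n
    unfolding a_def by measurable
  have a_le: "cmod (a n t) \<le> cmod (v t)" for n t
    by (simp add: a_def)
  have a_L2: "L2 (a n)" for n
    unfolding L2_iff
    by (auto intro!: Bochner_Integration.integrable_bound[OF iv] power_mono a_le)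
  have a_int: "integrable lborel (a n)" for n
  proof (rule Bochner_Integration.integrable_bound[where f = "\<lambda>t. Suc n * (cmod (v t))\<^sup>2"])
    show "AE t in lborel. norm (a n t) \<le> norm (Suc n * (cmod (v t))\<^sup>2)"
    proof (intro AE_I2)
      fix t
      have "cmod (v t) \<le> Suc n * (cmod (v t))\<^sup>2" if "1 / Suc n \<le> cmod (v t)"
      proof -
        have "1 \<le> Suc n * cmod (v t)"
          using that by (simp add: field_simps)
        then have "1 * cmod (v t) \<le> (Suc n * cmod (v t)) * cmod (v t)"
          by (intro mult_right_mono) auto
        then show ?thesis
          by (simp add: power2_eq_square mult_ac)
      qed
      then show "norm (a n t) \<le> norm (Suc n * (cmod (v t))\<^sup>2)"
        by (auto simp: a_def)
    qed
  qed (use iv in auto)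
  have "(\<lambda>n. LINT t|lborel. (cmod (v t - a n t))\<^sup>2) \<longlonglongrightarrow> (LINT t::real|lborel. 0)"
  proof (rule integral_dominated_convergence[OF _ _ iv])
    show "AE t in lborel. (\<lambda>n. (cmod (v t - a n t))\<^sup>2) \<longlonglongrightarrow> 0"
    proof (intro AE_I2 tendsto_eventually)
      fix t
      show "eventually (\<lambda>n. (cmod (v t - a n t))\<^sup>2 = 0) sequentially"
      proof (cases "v t = 0")
        case True
        then show ?thesis by (simp add: a_def)
      next
        case False
        obtain n1 where n1: "cmod (v t) < real n1"
          using reals_Archimedean2 by blast
        obtain n2 where n2: "1 / cmod (v t) < real n2"
          using reals_Archimedean2 by blast
        have "(cmod (v t - a n t))\<^sup>2 = 0" if "n \<ge> max n1 n2" for n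
        proof -
          have "1 / cmod (v t) < real (Suc n)" "cmod (v t) < real (Suc n)"
            using n1 n2 that by linarith+
          then show ?thesis
            using False by (auto simp: a_def field_simps)
        qed
        then show ?thesis
          unfolding eventually_sequentially by blast
      qed
    qed
    show "AE t in lborel. norm ((cmod (v t - a n t))\<^sup>2) \<le> (cmod (v t))\<^sup>2" for n
      by (auto simp: a_def)
  qed auto
  then have "eventually (\<lambda>n. (LINT t|lborel. (cmod (v t - a n t))\<^sup>2) < e) sequentially"
    using \<open>e > 0\<close> by (auto dest: order_tendstoD)
  then obtain n where "(LINT t|lborel. (cmod (v t - a n t))\<^sup>2) < e"
    using eventually_happens'[OF sequentially_bot] by blast
  moreover have "cmod (a n t) \<le> Suc n" for t
    by (auto simp: a_def)
  ultimately show ?thesis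
    using that[of "a n" "Suc n"] a_L2 a_int by blast
qed

text \<open>For \<open>a\<close> bounded by M, the squared modulus of \<open>a (t - s) - a t\<close>
  is at most 2M times the modulus, so the L1 result applies to a bounded integrable
  approximant.\<close>

lemma translate_L2_tendsto:
  assumes v: "L2 v"
  shows "((\<lambda>s. LINT t|lborel. (cmod (v (t - s) - v t))\<^sup>2) \<longlongrightarrow> 0) (at 0)"
proof (rule tendstoI)
  fix e :: real
  assume e: "e > 0"
  \<comment> \<open>The approximation error appears in two integrals, each with factor 3, so the
    bound e / 12 contributes less than e / 2 in total. The factor \<open>6 * M\<close> below is 3
    times \<open>2 * M\<close>.\<close>
  then obtain a M where a: "integrable lborel a" "L2 a" "\<And>t. cmod (a t) \<le> M"
    and ap: "(LINT t|lborel. (cmod (v t - a t))\<^sup>2) < e / 12"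
    using L2_bounded_approx[OF v, of "e / 12"] by auto
  have M: "M \<ge> 0"
    using a(3)[of 0] norm_ge_zero order_trans by blast
  have "((\<lambda>s. (LINT t|lborel. norm (a (t - s) - a t)) * (6 * M)) \<longlongrightarrow> 0) (at 0)"
    by (intro tendsto_mult_left_zero translate_L1_tendsto a)
  then have "eventually (\<lambda>s. dist ((LINT t|lborel. norm (a (t - s) - a t)) * (6 * M)) 0 < e / 2) (at 0)"
    using e by (intro tendstoD) auto
  then show "eventually (\<lambda>s. dist (LINT t|lborel. (cmod (v (t - s) - v t))\<^sup>2) 0 < e) (at 0)"
  proof eventually_elim
    case (elim s)
    let ?A = "\<lambda>t. norm (a (t - s) - a t)"
    let ?D = "\<lambda>t. (cmod (v t - a t))\<^sup>2"
    have iA: "integrable lborel ?A"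
      using a(1) integrable_translate[OF a(1), of s] by simp
    have iD: "integrable lborel ?D"
      by (rule L2_power2_diff[OF v a(2)])
    have iD': "integrable lborel (\<lambda>t. ?D (t - s))"
      by (rule integrable_translate[OF iD])
    have "(LINT t|lborel. (cmod (v (t - s) - v t))\<^sup>2)
        \<le> (LINT t|lborel. (6 * M) * ?A t + 3 * ?D (t - s) + 3 * ?D t)"
    proof (rule integral_mono)
      show "integrable lborel (\<lambda>t. (cmod (v (t - s) - v t))\<^sup>2)"
        by (rule L2_power2_diff[OF L2_translate[OF v] v])
      show "(cmod (v (t - s) - v t))\<^sup>2 \<le> (6 * M) * ?A t + 3 * ?D (t - s) + 3 * ?D t" for t
      proof -
        have sq: "(x + y + z)\<^sup>2 \<le> 3 * x\<^sup>2 + 3 * y\<^sup>2 + 3 * z\<^sup>2" for x y z :: real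
          using sum_squares_bound[of x y] sum_squares_bound[of y z] sum_squares_bound[of x z]
          by (simp add: power2_eq_square algebra_simps)
        have "(cmod (v (t - s) - v t))\<^sup>2 \<le> (?A t + cmod (v (t - s) - a (t - s)) + cmod (v t - a t))\<^sup>2"
          by (intro power_mono norm_ge_zero) norm
        also have "\<dots> \<le> 3 * (?A t)\<^sup>2 + 3 * ?D (t - s) + 3 * ?D t"
          by (rule sq)
        also have "(?A t)\<^sup>2 \<le> (2 * M) * ?A t"
          using norm_triangle_ineq4[of "a (t - s)" "a t"] a(3)[of t] a(3)[of "t - s"]
          by (auto simp: power2_eq_square intro!: mult_right_mono)
        finally show ?thesis by simp
      qed
    qed (use iA iD iD' in auto)
    also have "\<dots> = (6 * M) * (LINT t|lborel. ?A t) + 3 * (LINT t|lborel. ?D (t - s)) + 3 * (LINT t|lborel. ?D t)"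
      using iA iD iD' by simp
    also have "(LINT t|lborel. ?D (t - s)) = (LINT t|lborel. ?D t)"
      by (rule integral_translate)
    also have "(6 * M) * (LINT t|lborel. ?A t) + 3 * (LINT t|lborel. ?D t) + 3 * (LINT t|lborel. ?D t) < e"
    proof -
      have "(LINT t|lborel. ?A t) * (6 * M) < e / 2"
        using elim M by (simp add: abs_mult)
      then show ?thesis
        using ap by (simp add: mult_ac)
    qed
    finally show ?case
      by (simp add: abs_less_iff)
  qed
qed

text \<open>A weighted arithmetic-geometric inequality plays the part of Cauchy-Schwarz.\<close>

lemma translate_L2_mult_tendsto:
  assumes u: "L2 u" and v: "L2 v"
  shows "((\<lambda>s. LINT t|lborel. cmod (u t) * cmod (v (t - s) - v t)) \<longlongrightarrow> 0) (at 0)"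
proof (rule tendstoI)
  fix e :: real
  assume e: "e > 0"
  define U where "U = (LINT t|lborel. (cmod (u t))\<^sup>2)"
  have U: "U \<ge> 0"
    by (simp add: U_def)
  \<comment> \<open>The weight in xy \<le> l x^2 / 2 + y^2 / (2 l). It makes the first term at most
    e / 2, and a squared translation error below e * l makes the second less than e / 2. The 1 in
    the denominator covers the case U = 0.\<close>
  define l where "l = e / (U + 1)"
  have l: "l > 0"
    using e U by (simp add: l_def)
  have "eventually (\<lambda>s. dist (LINT t|lborel. (cmod (v (t - s) - v t))\<^sup>2) 0 < e * l) (at 0)"
    using e l by (intro tendstoD translate_L2_tendsto v) auto
  then show "eventually (\<lambda>s. dist (LINT t|lborel. cmod (u t) * cmod (v (t - s) - v t)) 0 < e) (at 0)"
  proof eventually_elim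
    case (elim s)
    have iu: "integrable lborel (\<lambda>t. (cmod (u t))\<^sup>2)"
      using u by (simp add: L2_iff)
    have iv: "integrable lborel (\<lambda>t. (cmod (v (t - s) - v t))\<^sup>2)"
      by (rule L2_power2_diff[OF L2_translate[OF v] v])
    have iuv: "integrable lborel (\<lambda>t. cmod (u t) * cmod (v (t - s) - v t))"
      using integrable_norm[OF integrable_L2_mult[OF u L2_diff[OF L2_translate[OF v] v]]]
      by (simp add: norm_mult)
    have "(LINT t|lborel. cmod (u t) * cmod (v (t - s) - v t))
        \<le> (LINT t|lborel. l / 2 * (cmod (u t))\<^sup>2 + (1 / (2 * l)) * (cmod (v (t - s) - v t))\<^sup>2)"
    proof (rule integral_mono[OF iuv])
      have "x * y \<le> l / 2 * x\<^sup>2 + (1 / (2 * l)) * y\<^sup>2" for x y :: real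
        using sum_squares_bound[of "l * x" y] l by (simp add: field_simps power2_eq_square)
      then show "cmod (u t) * cmod (v (t - s) - v t)
          \<le> l / 2 * (cmod (u t))\<^sup>2 + (1 / (2 * l)) * (cmod (v (t - s) - v t))\<^sup>2" for t .
    qed (use iu iv in auto)
    also have "\<dots> = l / 2 * U + (1 / (2 * l)) * (LINT t|lborel. (cmod (v (t - s) - v t))\<^sup>2)"
      using iu iv by (simp add: U_def)
    also have "\<dots> < e / 2 + (1 / (2 * l)) * (e * l)"
    proof (rule add_le_less_mono)
      have "l * U \<le> e"
        using e U by (simp add: l_def field_simps)
      then show "l / 2 * U \<le> e / 2" by simp
      show "(1 / (2 * l)) * (LINT t|lborel. (cmod (v (t - s) - v t))\<^sup>2) < (1 / (2 * l)) * (e * l)"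
        using elim l by (intro mult_strict_left_mono) (auto simp: abs_less_iff)
    qed
    also have "\<dots> = e"
      using l by simp
    finally show ?case
      by (simp add: abs_less_iff)
  qed
qed

subsection \<open>Correlations and the Fourier transform\<close>

text \<open>No conjugate is built in: an autocorrelation is
  \<open>corr u (\<lambda>t. cnj (u t))\<close>.\<close>

definition corr :: "(real \<Rightarrow> complex) \<Rightarrow> (real \<Rightarrow> complex) \<Rightarrow> real \<Rightarrow> complex" where
  "corr u v s = (LINT t|lborel. u t * v (t - s))"

text \<open>What matters is a bound uniform in the shift, so the sum of the squared norms replaces
  the product of the norms.\<close>

lemma norm_corr_le:
  assumes u: "L2 u" and v: "L2 v"
  shows "cmod (corr u v s) \<le> (LINT t|lborel. (cmod (u t))\<^sup>2) + (LINT t|lborel. (cmod (v t))\<^sup>2)"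
proof -
  have iu: "integrable lborel (\<lambda>t. (cmod (u t))\<^sup>2)" and iv: "integrable lborel (\<lambda>t. (cmod (v (t - s)))\<^sup>2)"
    using u L2_translate[OF v] by (auto simp: L2_iff)
  have i: "integrable lborel (\<lambda>t. cmod (u t * v (t - s)))"
    using integrable_norm[OF integrable_L2_mult[OF u L2_translate[OF v]]] .
  have "cmod (corr u v s) \<le> (LINT t|lborel. cmod (u t * v (t - s)))"
    unfolding corr_def by (rule integral_norm_bound)
  also have "\<dots> \<le> (LINT t|lborel. (cmod (u t))\<^sup>2 + (cmod (v (t - s)))\<^sup>2)"
  proof (rule integral_mono[OF i])
    fix t
    show "cmod (u t * v (t - s)) \<le> (cmod (u t))\<^sup>2 + (cmod (v (t - s)))\<^sup>2"
      using sum_squares_bound[of "cmod (u t)" "cmod (v (t - s))"]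
          mult_nonneg_nonneg[of "cmod (u t)" "cmod (v (t - s))"]
      by (simp add: norm_mult del: mult_nonneg_nonneg)
  qed (use iu iv in auto)
  also have "\<dots> = (LINT t|lborel. (cmod (u t))\<^sup>2) + (LINT t|lborel. (cmod (v (t - s)))\<^sup>2)"
    using iu iv by simp
  also have "(LINT t|lborel. (cmod (v (t - s)))\<^sup>2) = (LINT t|lborel. (cmod (v t))\<^sup>2)"
    by (rule integral_translate)
  finally show ?thesis .
qed

text \<open>The increment at \<open>s\<close> integrates \<open>u\<close> against the difference
  between the shifted \<open>v\<close> and a small translate of it, so it is controlled by
  \<open>translate_L2_mult_tendsto\<close>.\<close>

lemma continuous_corr:
  assumes u: "L2 u" and v: "L2 v"
  shows "continuous_on UNIV (corr u v)"
proof (intro continuous_at_imp_continuous_on ballI)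
  fix s
  let ?v = "\<lambda>t. v (t - s)"
  have v': "L2 ?v"
    by (rule L2_translate[OF v])
  have "((\<lambda>h. corr u v (s + h) - corr u v s) \<longlongrightarrow> 0) (at 0)"
  proof (rule tendsto_0_le[OF translate_L2_mult_tendsto[OF u v'], of _ 1], intro always_eventually allI)
    fix h
    have i1: "integrable lborel (\<lambda>t. u t * ?v (t - h))"
      using integrable_L2_mult[OF u L2_translate[OF v', of h]] .
    have i2: "integrable lborel (\<lambda>t. u t * ?v t)"
      using integrable_L2_mult[OF u v'] .
    have "corr u v (s + h) - corr u v s = (LINT t|lborel. u t * (?v (t - h) - ?v t))"
      using i1 i2 by (simp add: corr_def algebra_simps)
    also have "cmod \<dots> \<le> (LINT t|lborel. cmod (u t * (?v (t - h) - ?v t)))"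
      by (rule integral_norm_bound)
    finally show "cmod (corr u v (s + h) - corr u v s)
        \<le> norm (LINT t|lborel. cmod (u t) * cmod (?v (t - h) - ?v t)) * 1"
      by (simp add: norm_mult)
  qed
  then have "((\<lambda>h. corr u v (s + h)) \<longlongrightarrow> corr u v s) (at 0)"
    by (simp add: LIM_zero_cancel)
  then show "isCont (corr u v) s"
    by (simp add: isCont_iff)
qed

section \<open>Elementary properties of the Fourier transform\<close>

text \<open>The positive sign in the exponent matches the synthesis integral of the Paley-Wiener
  space, so a band-limited function on the real line is \<open>ft F\<close> itself, while the
  short-time transform becomes \<open>ft\<close> at the negated frequency.\<close>

definition ft :: "(real \<Rightarrow> complex) \<Rightarrow> real \<Rightarrow> complex" where
  "ft h \<omega> = (LINT t|lborel. h t * cis (2 * pi * t * \<omega>))"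

lemma integrable_mult_bounded:
  fixes h w :: "'a \<Rightarrow> complex"
  assumes "integrable M h" and [measurable]: "w \<in> borel_measurable M" and "\<And>t. cmod (w t) \<le> C"
  shows "integrable M (\<lambda>t. h t * w t)"
proof (rule Bochner_Integration.integrable_bound[where f = "\<lambda>t. C * norm (h t)"])
  show "AE t in M. norm (h t * w t) \<le> norm (C * norm (h t))"
  proof (intro AE_I2)
    fix t
    have "cmod (w t) \<le> \<bar>C\<bar>" using assms(3)[of t] by linarith
    then show "norm (h t * w t) \<le> norm (C * norm (h t))"
      using mult_right_mono[of "cmod (w t)" "\<bar>C\<bar>" "cmod (h t)"] by (simp add: norm_mult abs_mult mult.commute)
  qed
qed (use assms in auto)

lemma integrable_mult_cis:
  assumes "integrable lborel h"
  shows "integrable lborel (\<lambda>t. h t * cis (c * t * d))"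
  by (rule integrable_mult_bounded[OF assms, where C = 1]) auto

lemma norm_ft_le: "cmod (ft h \<omega>) \<le> (LINT t|lborel. cmod (h t))"
  using integral_norm_bound[of lborel "\<lambda>t. h t * cis (2 * pi * t * \<omega>)"]
  by (simp add: ft_def norm_mult)

lemma continuous_ft:
  assumes "integrable lborel h"
  shows "continuous_on UNIV (ft h)"
proof (rule continuous_at_imp_continuous_on, intro ballI)
  fix \<omega>
  show "isCont (ft h) \<omega>"
    unfolding isCont_def tendsto_at_iff_sequentially
  proof (intro allI impI)
    fix X :: "nat \<Rightarrow> real"
    assume X: "X \<longlonglongrightarrow> \<omega>"
    have "(\<lambda>n. LINT t|lborel. h t * cis (2 * pi * t * X n)) \<longlonglongrightarrow> (LINT t|lborel. h t * cis (2 * pi * t * \<omega>))"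
    proof (rule integral_dominated_convergence[where w = "\<lambda>t. norm (h t)"])
      show "AE t in lborel. (\<lambda>n. h t * cis (2 * pi * t * X n)) \<longlonglongrightarrow> h t * cis (2 * pi * t * \<omega>)"
        by (intro AE_I2 tendsto_intros X)
    qed (use assms in \<open>auto simp: norm_mult\<close>)
    then show "(ft h \<circ> X) \<longlonglongrightarrow> ft h \<omega>"
      by (simp add: o_def ft_def)
  qed
qed

lemma borel_measurable_ft [measurable]:
  assumes "integrable lborel h"
  shows "ft h \<in> borel_measurable borel"
  by (rule borel_measurable_continuous_onI[OF continuous_ft[OF assms]])

lemma ft_diff:
  assumes "integrable lborel u" "integrable lborel v"
  shows "ft (\<lambda>t. u t - v t) \<omega> = ft u \<omega> - ft v \<omega>"
  using integrable_mult_cis[OF assms(1), of "2 * pi" \<omega>] integrable_mult_cis[OF assms(2), of "2 * pi" \<omega>]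
  by (simp add: ft_def left_diff_distrib)

lemma ft_cnj: "ft (\<lambda>t. cnj (u t)) \<omega> = cnj (ft u (- \<omega>))"
  using Bochner_Integration.integral_cnj[of lborel "\<lambda>t. u t * cis (2 * pi * t * (- \<omega>))"]
  by (simp add: ft_def cis_cnj)

lemma ft_modulate: "ft (\<lambda>t. u t * cis (2 * pi * t * a)) \<omega> = ft u (a + \<omega>)"
  by (simp add: ft_def mult.assoc cis_mult distrib_left)

lemma integrable_pair_mult:
  fixes u v :: "real \<Rightarrow> complex"
  assumes u: "integrable lborel u" and v: "integrable lborel v"
  shows "integrable (lborel \<Otimes>\<^sub>M lborel) (\<lambda>(x, y). u x * v y)"
proof (rule lborel_pair.Fubini_integrable)
  show "(\<lambda>(x, y). u x * v y) \<in> borel_measurable (lborel \<Otimes>\<^sub>M lborel)"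
    using borel_measurable_integrable[OF u] borel_measurable_integrable[OF v] by measurable
qed (use u v in \<open>auto simp: norm_mult\<close>)

text \<open>Fubini moves the transform from one factor to the other. With a modulated Gaussian as
  second factor, this stands in for the inversion theorem.\<close>

lemma ft_multiplication:
  assumes u: "integrable lborel u" and v: "integrable lborel v"
  shows "(LINT t|lborel. ft u t * v t) = (LINT x|lborel. u x * ft v x)"
proof -
  have "integrable (lborel \<Otimes>\<^sub>M lborel) (\<lambda>p. (case p of (x, t) \<Rightarrow> u x * v t) * cis (2 * pi * fst p * snd p))"
    by (rule integrable_mult_bounded[OF integrable_pair_mult[OF u v], where C = 1]) auto
  then have i: "integrable (lborel \<Otimes>\<^sub>M lborel) (\<lambda>(x, t). u x * v t * cis (2 * pi * x * t))"
    by (simp add: case_prod_unfold)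
  have "(LINT t|lborel. ft u t * v t) = (LINT t|lborel. LINT x|lborel. u x * v t * cis (2 * pi * x * t))"
    unfolding ft_def
    by (intro Bochner_Integration.integral_cong refl)
       (simp add: mult_ac flip: integral_mult_right_zero integral_mult_left_zero)
  also have "\<dots> = (LINT x|lborel. LINT t|lborel. u x * v t * cis (2 * pi * x * t))"
    by (rule lborel_pair.Fubini_integral[OF i])
  also have "\<dots> = (LINT x|lborel. u x * ft v x)"
    unfolding ft_def
    by (intro Bochner_Integration.integral_cong refl)
       (simp add: mult_ac flip: integral_mult_right_zero)
  finally show ?thesis .
qed

text \<open>Fubini, then replacing s by t - s, splits the exponential into a factor in t and a
  factor in s. The transform of \<open>v\<close> sits at \<open>- \<omega>\<close> because
  \<open>v\<close> is read at t - s.\<close>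

lemma
  assumes u: "integrable lborel u" and v: "integrable lborel v"
  shows integrable_corr: "integrable lborel (corr u v)"
    and ft_corr: "ft (corr u v) \<omega> = ft u \<omega> * ft v (- \<omega>)"
proof -
  note [measurable] = borel_measurable_integrable[OF u] borel_measurable_integrable[OF v]
  have i: "integrable (lborel \<Otimes>\<^sub>M lborel) (\<lambda>(t, s). u t * v (t - s))"
  proof (rule lborel_pair.Fubini_integrable)
    show "(\<lambda>(t, s). u t * v (t - s)) \<in> borel_measurable (lborel \<Otimes>\<^sub>M lborel)"
      by measurable
    have "(LINT s|lborel. norm (u t * v (t - s))) = norm (u t) * (LINT s|lborel. norm (v s))" for t
      using lborel_integral_real_affine[of "-1" "\<lambda>s. norm (v s)" t] by (simp add: norm_mult)
    then show "integrable lborel (\<lambda>t. LINT s|lborel. norm (case (t, s) of (t, s) \<Rightarrow> u t * v (t - s)))"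
      using u by simp
  qed (use integrable_reflect[OF v] in auto)
  show "integrable lborel (corr u v)"
    unfolding corr_def by (rule lborel_pair.integrable_snd[OF i])
  have "integrable (lborel \<Otimes>\<^sub>M lborel) (\<lambda>p. (case p of (t, s) \<Rightarrow> u t * v (t - s)) * cis (2 * pi * snd p * \<omega>))"
    by (rule integrable_mult_bounded[OF i, where C = 1]) auto
  then have i': "integrable (lborel \<Otimes>\<^sub>M lborel) (\<lambda>(t, s). u t * v (t - s) * cis (2 * pi * s * \<omega>))"
    by (simp add: case_prod_unfold)
  have "ft (corr u v) \<omega> = (LINT s|lborel. LINT t|lborel. u t * v (t - s) * cis (2 * pi * s * \<omega>))"
    unfolding ft_def corr_def by simp
  also have "\<dots> = (LINT t|lborel. LINT s|lborel. u t * v (t - s) * cis (2 * pi * s * \<omega>))"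
    by (rule lborel_pair.Fubini_integral[OF i'])
  also have "\<dots> = (LINT t|lborel. u t * cis (2 * pi * t * \<omega>) * ft v (- \<omega>))"
  proof (intro Bochner_Integration.integral_cong refl)
    fix t
    have "(LINT s|lborel. u t * v (t - s) * cis (2 * pi * s * \<omega>))
        = (LINT s|lborel. u t * v s * cis (2 * pi * (t - s) * \<omega>))"
      using lborel_integral_real_affine[of "-1" "\<lambda>s. u t * v s * cis (2 * pi * (t - s) * \<omega>)" t] by simp
    also have "\<dots> = (LINT s|lborel. u t * cis (2 * pi * t * \<omega>) * (v s * cis (2 * pi * s * (- \<omega>))))"
      by (intro Bochner_Integration.integral_cong refl)
         (simp add: mult_ac cis_mult algebra_simps)
    finally show "(LINT s|lborel. u t * v (t - s) * cis (2 * pi * s * \<omega>)) = u t * cis (2 * pi * t * \<omega>) * ft v (- \<omega>)"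
      by (simp add: ft_def)
  qed
  also have "\<dots> = ft u \<omega> * ft v (- \<omega>)"
    by (simp add: ft_def)
  finally show "ft (corr u v) \<omega> = ft u \<omega> * ft v (- \<omega>)" .
qed

section \<open>Gaussian kernels and uniqueness of the Fourier transform\<close>

definition gauss :: "real \<Rightarrow> real \<Rightarrow> complex" where
  "gauss k t = exp (- (t / k)\<^sup>2 / 2)"

text \<open>The transform of \<open>gauss k\<close> for positive \<open>k\<close>: a normal density
  whose deviation shrinks as \<open>k\<close> grows, hence an approximate identity.\<close>

definition gauss_ft :: "real \<Rightarrow> real \<Rightarrow> complex" where
  "gauss_ft k u = complex_of_real (normal_density 0 (1 / (2 * pi * k)) u)"

lemma borel_measurable_gauss [measurable]: "gauss k \<in> borel_measurable borel"
  unfolding gauss_def by measurable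

lemma norm_gauss_le: "cmod (gauss k t) \<le> 1"
  by (simp add: gauss_def)

lemma gauss_tendsto: "(\<lambda>n. gauss (Suc n) t) \<longlonglongrightarrow> 1"
proof -
  have "(\<lambda>n. t / real (Suc n)) \<longlonglongrightarrow> 0"
    by (rule LIMSEQ_Suc) (rule lim_const_over_n)
  from tendsto_power[OF this, of 2]
  have "(\<lambda>n. complex_of_real (exp (- (t / real (Suc n))\<^sup>2 / 2))) \<longlonglongrightarrow> complex_of_real (exp (- 0 / 2))"
    by (intro tendsto_intros) auto
  then show ?thesis
    by (simp add: gauss_def)
qed

lemma gauss_eq: "k > 0 \<Longrightarrow> gauss k t = sqrt (2 * pi) * std_normal_density (t / k)"
  by (simp add: gauss_def std_normal_density_def)

lemma integrable_gauss:
  assumes "k > 0"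
  shows "integrable lborel (gauss k)"
proof -
  have "integrable lborel (\<lambda>t. std_normal_density (0 + (1 / k) * t))"
    using assms by (intro lborel_integrable_real_affine) auto
  then have "integrable lborel (\<lambda>t. complex_of_real (sqrt (2 * pi) * std_normal_density (t / k)))"
    by (intro integrable_of_real integrable_mult_right) auto
  then show ?thesis
    using gauss_eq[OF assms] by (simp add: fun_eq_iff[of "gauss k"] cong: Bochner_Integration.integrable_cong)
qed

text \<open>The substitution t = k x reduces the integral to the characteristic function of the
  standard normal distribution at 2 pi k u.\<close>

lemma ft_gauss:
  assumes "k > 0"
  shows "ft (gauss k) u = gauss_ft k u"
proof -
  have "ft (gauss k) u = k *\<^sub>R (LINT x|lborel. gauss k (k * x) * cis (2 * pi * (k * x) * u))"
    unfolding ft_def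
    using lborel_integral_real_affine[of k "\<lambda>t. gauss k t * cis (2 * pi * t * u)" 0] assms by simp
  also have "(LINT x|lborel. gauss k (k * x) * cis (2 * pi * (k * x) * u))
      = (LINT x|lborel. sqrt (2 * pi) *\<^sub>R (std_normal_density x *\<^sub>R iexp ((2 * pi * k * u) * x)))"
    using assms by (intro Bochner_Integration.integral_cong refl)
      (simp add: gauss_eq scaleR_conv_of_real cis_conv_exp mult_ac)
  also have "\<dots> = sqrt (2 * pi) *\<^sub>R (LINT x|lborel. std_normal_density x *\<^sub>R iexp ((2 * pi * k * u) * x))"
    by (rule integral_scaleR_right)
  also have "(LINT x|lborel. std_normal_density x *\<^sub>R iexp ((2 * pi * k * u) * x))
      = char std_normal_distribution (2 * pi * k * u)"
    unfolding char_def by (subst integral_density) auto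
  also have "\<dots> = complex_of_real (exp (- ((2 * pi * k * u)\<^sup>2) / 2))"
    by (simp add: char_std_normal_distribution)
  finally have "ft (gauss k) u = complex_of_real (k * sqrt (2 * pi) * exp (- ((2 * pi * k * u)\<^sup>2) / 2))"
    by (simp add: scaleR_conv_of_real)
  also have "k * sqrt (2 * pi) * exp (- ((2 * pi * k * u)\<^sup>2) / 2) = normal_density 0 (1 / (2 * pi * k)) u"
  proof -
    have "1 / sqrt (2 * pi * (1 / (2 * pi * k))\<^sup>2) = k * sqrt (2 * pi)"
      using assms by (simp add: real_sqrt_mult real_sqrt_divide field_simps)
    moreover have "- ((2 * pi * k * u)\<^sup>2) / 2 = - (u - 0)\<^sup>2 / (2 * (1 / (2 * pi * k))\<^sup>2)"
      using assms by (simp add: field_simps power2_eq_square)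
    ultimately show ?thesis
      by (simp add: normal_density_def)
  qed
  finally show ?thesis
    by (simp add: gauss_ft_def)
qed

text \<open>Moves the dependence on \<open>k\<close> from the kernel into the argument of the other
  factor: the weight becomes a fixed density, as dominated convergence requires.\<close>

lemma gauss_ft_rescale:
  assumes "k > 0"
  shows "gauss_ft k (v / (2 * pi * k)) = 2 * pi * k * std_normal_density v"
proof -
  have "1 / sqrt (2 * pi * (1 / (2 * pi * k))\<^sup>2) = 2 * pi * k / sqrt (2 * pi)"
    using assms by (simp add: real_sqrt_mult real_sqrt_divide field_simps)
  moreover have "- (v / (2 * pi * k) - 0)\<^sup>2 / (2 * (1 / (2 * pi * k))\<^sup>2) = - v\<^sup>2 / 2"
    using assms by (simp add: field_simps power2_eq_square)
  ultimately have "normal_density 0 (1 / (2 * pi * k)) (v / (2 * pi * k)) = 2 * pi * k * std_normal_density v"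
    by (simp add: normal_density_def)
  then show ?thesis
    by (simp add: gauss_ft_def)
qed

text \<open>Testing the vanishing transform against Gaussians modulated by \<open>- x\<close> shows
  that Gaussian averages of \<open>h\<close> around \<open>x\<close> vanish. As the Gaussians widen
  in frequency, the averages concentrate at \<open>x\<close> and tend to \<open>h x\<close> by
  continuity; boundedness supplies the majorant.\<close>

lemma ft_eq_0_imp_eq_0:
  assumes h: "integrable lborel h" and c: "continuous_on UNIV h" and b: "\<And>t. cmod (h t) \<le> C"
    and 0: "\<And>\<omega>. ft h \<omega> = 0"
  shows "h x = 0"
proof -
  have [measurable]: "h \<in> borel_measurable borel"
    using borel_measurable_integrable[OF h] by simp
  have eq: "(LINT v|lborel. h (x + v / (2 * pi * Suc n)) * std_normal_density v) = 0" for n :: nat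
  proof -
    define k where "k = real (Suc n)"
    have k: "k > 0" by (simp add: k_def)
    have ig: "integrable lborel (\<lambda>\<omega>. gauss k \<omega> * cis (2 * pi * \<omega> * (- x)))"
      by (rule integrable_mult_cis[OF integrable_gauss[OF k]])
    have "0 = (LINT t|lborel. ft h t * (gauss k t * cis (2 * pi * t * (- x))))"
      by (simp add: 0)
    also have "\<dots> = (LINT t|lborel. h t * ft (\<lambda>\<omega>. gauss k \<omega> * cis (2 * pi * \<omega> * (- x))) t)"
      by (rule ft_multiplication[OF h ig])
    also have "\<dots> = (LINT t|lborel. h t * gauss_ft k (- x + t))"
      by (simp only: ft_modulate ft_gauss[OF k])
    also have "\<dots> = \<bar>1 / (2 * pi * k)\<bar> *\<^sub>R (LINT v|lborel. h (x + 1 / (2 * pi * k) * v) * gauss_ft k (- x + (x + 1 / (2 * pi * k) * v)))"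
      by (rule lborel_integral_real_affine) (use k in simp)
    also have "\<dots> = (LINT v|lborel. \<bar>1 / (2 * pi * k)\<bar> *\<^sub>R (h (x + 1 / (2 * pi * k) * v) * gauss_ft k (- x + (x + 1 / (2 * pi * k) * v))))"
      by simp
    also have "\<dots> = (LINT v|lborel. h (x + v / (2 * pi * k)) * std_normal_density v)"
      using gauss_ft_rescale[OF k] k
      by (intro Bochner_Integration.integral_cong refl) (simp add: scaleR_conv_of_real)
    finally show ?thesis
      by (simp add: k_def)
  qed
  have "(\<lambda>n. LINT v|lborel. h (x + v / (2 * pi * Suc n)) * std_normal_density v)
      \<longlonglongrightarrow> (LINT v|lborel. h x * std_normal_density v)"
  proof (rule integral_dominated_convergence[where w = "\<lambda>v. C * std_normal_density v"])
    show "AE v in lborel. (\<lambda>n. h (x + v / (2 * pi * Suc n)) * std_normal_density v) \<longlonglongrightarrow> h x * std_normal_density v"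
    proof (intro AE_I2 tendsto_mult tendsto_const)
      fix v
      have "(\<lambda>n. (v / (2 * pi)) / real (Suc n)) \<longlonglongrightarrow> 0"
        by (rule LIMSEQ_Suc) (rule lim_const_over_n)
      then have "(\<lambda>n. x + v / (2 * pi * Suc n)) \<longlonglongrightarrow> x + 0"
        by (intro tendsto_intros) (simp add: field_simps)
      moreover have "isCont h (x + 0)"
        using c by (simp add: continuous_on_eq_continuous_at)
      ultimately show "(\<lambda>n. h (x + v / (2 * pi * Suc n))) \<longlonglongrightarrow> h x"
        using isCont_tendsto_compose by fastforce
    qed
    show "integrable lborel (\<lambda>v. C * std_normal_density v)"
      by auto
    show "AE v in lborel. norm (h (x + v / (2 * pi * Suc n)) * std_normal_density v) \<le> C * std_normal_density v" for n
      using b by (auto simp: norm_mult intro!: mult_right_mono)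
  qed auto
  then have "(LINT v|lborel. h x * std_normal_density v) = 0"
    unfolding eq by (simp add: LIMSEQ_const_iff)
  moreover have "(LINT v|lborel. h x * std_normal_density v) = h x"
    using integral_of_real[of lborel std_normal_density, where 'a = complex] by simp
  ultimately show ?thesis
    by simp
qed

lemma ft_inject:
  assumes h: "integrable lborel h" "continuous_on UNIV h" "\<And>t. cmod (h t) \<le> C"
    and k: "integrable lborel k" "continuous_on UNIV k" "\<And>t. cmod (k t) \<le> D"
    and eq: "\<And>\<omega>. ft h \<omega> = ft k \<omega>"
  shows "h = k"
proof
  fix x
  have "h x - k x = 0"
  proof (rule ft_eq_0_imp_eq_0[where h = "\<lambda>t. h t - k t" and C = "C + D"])
    show "cmod (h t - k t) \<le> C + D" for t
      using norm_triangle_ineq4[of "h t" "k t"] h(3)[of t] k(3)[of t] by linarith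
    show "ft (\<lambda>t. h t - k t) \<omega> = 0" for \<omega>
      using eq by (simp add: ft_diff h k)
  qed (use h k in \<open>auto intro: continuous_on_diff\<close>)
  then show "h x = k x" by simp
qed

section \<open>Gaussian summability: support and square integrability\<close>

text \<open>Damping the double transform by a Gaussian turns it into an integral of \<open>u\<close>
  against a normal density centred at \<open>- \<omega>\<close>.\<close>

lemma ft_ft_gauss:
  assumes u: "integrable lborel u" and "k > 0"
  shows "(LINT t|lborel. ft u t * (gauss k t * cis (2 * pi * t * \<omega>))) = (LINT x|lborel. u x * gauss_ft k (\<omega> + x))"
  using ft_multiplication[OF u integrable_mult_cis[OF integrable_gauss[OF \<open>k > 0\<close>], of "2 * pi" \<omega>]]
  by (simp only: ft_modulate ft_gauss[OF \<open>k > 0\<close>])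

lemma norm_gauss_ft: "cmod (gauss_ft k x) = normal_density 0 (1 / (2 * pi * k)) x"
  by (simp add: gauss_ft_def)

lemma normal_density_antimono:
  assumes "0 \<le> d" "d \<le> \<bar>x\<bar>"
  shows "normal_density 0 \<sigma> x \<le> normal_density 0 \<sigma> d"
proof -
  have "d\<^sup>2 \<le> x\<^sup>2"
    using assms by (simp add: abs_le_square_iff flip: abs_le_square_iff)
  then show ?thesis
    by (auto simp: normal_density_def intro!: divide_right_mono)
qed

lemma normal_density_narrow_tendsto:
  assumes "d > 0"
  shows "(\<lambda>n. normal_density 0 (1 / (2 * pi * real (Suc n))) d) \<longlonglongrightarrow> 0"
  using assms unfolding normal_density_def by real_asymp

lemma integrable_mult_gauss_ft:
  assumes "integrable lborel u"
  shows "integrable lborel (\<lambda>x. u x * gauss_ft k (a + x))"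
proof (rule integrable_mult_bounded[OF assms])
  show "(\<lambda>x. gauss_ft k (a + x)) \<in> borel_measurable lborel"
    unfolding gauss_ft_def by measurable
  show "cmod (gauss_ft k (a + x)) \<le> normal_density 0 (1 / (2 * pi * k)) 0" for x
    by (simp only: norm_gauss_ft) (rule normal_density_antimono, auto)
qed

text \<open>By Fourier inversion the double transform of \<open>u\<close> is the reflection of \<open>u\<close>, so it inherits
  its support; Gaussian summability replaces the inversion theorem.\<close>

lemma ft_ft_support:
  assumes u: "integrable lborel u" and fu: "integrable lborel (ft u)"
    and supp: "\<And>x. A < \<bar>x\<bar> \<Longrightarrow> u x = 0" and \<omega>: "A < \<bar>\<omega>\<bar>"
  shows "ft (ft u) \<omega> = 0"
proof -
  define d where "d = \<bar>\<omega>\<bar> - A"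
  have d: "d > 0"
    using \<omega> by (simp add: d_def)
  have [measurable]: "ft u \<in> borel_measurable borel"
    using u by measurable
  let ?I = "\<lambda>n. LINT t|lborel. ft u t * (gauss (Suc n) t * cis (2 * pi * t * \<omega>))"
  have "?I \<longlonglongrightarrow> (LINT t|lborel. ft u t * (1 * cis (2 * pi * t * \<omega>)))"
  proof (rule integral_dominated_convergence[where w = "\<lambda>t. norm (ft u t)"])
    show "AE t in lborel. (\<lambda>n. ft u t * (gauss (Suc n) t * cis (2 * pi * t * \<omega>))) \<longlonglongrightarrow> ft u t * (1 * cis (2 * pi * t * \<omega>))"
      by (intro AE_I2 tendsto_intros gauss_tendsto)
    show "AE t in lborel. norm (ft u t * (gauss (Suc n) t * cis (2 * pi * t * \<omega>))) \<le> norm (ft u t)" for n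
      using norm_gauss_le by (auto simp: norm_mult intro!: mult_left_le)
  qed (use fu in auto)
  then have lim: "?I \<longlonglongrightarrow> ft (ft u) \<omega>"
    by (simp add: ft_def[of "ft u"])
  \<comment> \<open>Where \<open>u\<close> is nonzero, |x| is at most \<open>A\<close>, so
    \<open>\<omega> + x\<close> stays at distance at least \<open>d\<close> from 0. There the
    kernels are bounded by their value at \<open>d\<close>, which tends to 0.\<close>
  have "?I \<longlonglongrightarrow> 0"
  proof (rule tendsto_0_le[OF normal_density_narrow_tendsto[OF d], of _ "LINT x|lborel. norm (u x)"],
      intro always_eventually allI)
    fix n
    let ?N = "normal_density 0 (1 / (2 * pi * real (Suc n))) d"
    have "?I n = (LINT x|lborel. u x * gauss_ft (Suc n) (\<omega> + x))"
      by (rule ft_ft_gauss[OF u]) simp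
    also have "norm \<dots> \<le> (LINT x|lborel. ?N * norm (u x))"
    proof (rule Bochner_Integration.integral_norm_bound_integral[OF integrable_mult_gauss_ft])
      show "integrable lborel (\<lambda>x. ?N * norm (u x))"
        using u by simp
      show "norm (u x * gauss_ft (Suc n) (\<omega> + x)) \<le> ?N * norm (u x)" for x
      proof (cases "A < \<bar>x\<bar>")
        case False
        then have "d \<le> \<bar>\<omega> + x\<bar>"
          using abs_triangle_ineq4[of "\<omega> + x" x] unfolding d_def by simp
        then have "cmod (gauss_ft (Suc n) (\<omega> + x)) \<le> ?N"
          unfolding norm_gauss_ft using d by (intro normal_density_antimono) auto
        from mult_right_mono[OF this norm_ge_zero[of "u x"]] show ?thesis
          by (simp add: norm_mult mult.commute)
      qed (simp add: supp)
    qed (rule u)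
    finally show "norm (?I n) \<le> norm ?N * (LINT x|lborel. norm (u x))"
      by simp
  qed
  then show ?thesis
    using lim LIMSEQ_unique by blast
qed

lemma ft_corr_cnj:
  assumes "integrable lborel u" "integrable lborel v"
  shows "ft (corr u (\<lambda>t. cnj (v t))) \<omega> = ft u \<omega> * cnj (ft v \<omega>)"
  using assms by (simp add: ft_corr ft_cnj)

text \<open>Half of Plancherel. The squared modulus of \<open>ft u\<close> is the transform of the
  autocorrelation of \<open>u\<close>; damped by a Gaussian, its integral is an average of that
  bounded autocorrelation against a probability density, hence bounded uniformly in the damping.
  Fatou's lemma removes the damping.\<close>

lemma L2_ft:
  assumes u: "integrable lborel u" and u2: "L2 u"
  shows "L2 (ft u)"
proof -
  let ?C = "corr u (\<lambda>t. cnj (u t))"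
  let ?N = "(LINT t|lborel. (cmod (u t))\<^sup>2) + (LINT t|lborel. (cmod (cnj (u t)))\<^sup>2)"
  have [measurable]: "ft u \<in> borel_measurable borel"
    using u by measurable
  have iC: "integrable lborel ?C"
    using u by (intro integrable_corr) auto
  have bound: "(\<integral>\<^sup>+t. ennreal ((cmod (ft u t))\<^sup>2 * cmod (gauss (Suc n) t)) \<partial>lborel) \<le> ennreal ?N" for n
  proof -
    define k where "k = real (Suc n)"
    have k: "k > 0" by (simp add: k_def)
    have i: "integrable lborel (\<lambda>t. (cmod (ft u t))\<^sup>2 * cmod (gauss k t))"
    proof -
      have "integrable lborel (\<lambda>t. gauss k t * of_real ((cmod (ft u t))\<^sup>2))"
        by (rule integrable_mult_bounded[OF integrable_gauss[OF k], where C = "(LINT t|lborel. cmod (u t))\<^sup>2"])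
           (auto simp: norm_power intro!: power_mono norm_ft_le)
      from integrable_norm[OF this] show ?thesis
        by (simp add: norm_mult norm_power mult.commute)
    qed
    have "complex_of_real (LINT t|lborel. (cmod (ft u t))\<^sup>2 * cmod (gauss k t))
        = (LINT t|lborel. ft ?C t * (gauss k t * cis (2 * pi * t * 0)))"
      unfolding Bochner_Integration.integral_complex_of_real[symmetric]
      by (intro Bochner_Integration.integral_cong refl)
         (simp add: ft_corr_cnj u complex_norm_square[symmetric] gauss_def)
    also have "\<dots> = (LINT x|lborel. ?C x * gauss_ft k (0 + x))"
      by (rule ft_ft_gauss[OF iC k])
    finally have "cmod (complex_of_real (LINT t|lborel. (cmod (ft u t))\<^sup>2 * cmod (gauss k t)))
        = cmod (LINT x|lborel. ?C x * gauss_ft k (0 + x))"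
      by (rule arg_cong)
    moreover have "0 \<le> (LINT t|lborel. (cmod (ft u t))\<^sup>2 * cmod (gauss k t))"
      by (intro Bochner_Integration.integral_nonneg) simp
    ultimately have "(LINT t|lborel. (cmod (ft u t))\<^sup>2 * cmod (gauss k t))
        = cmod (LINT x|lborel. ?C x * gauss_ft k (0 + x))"
      by (simp only: norm_of_real abs_of_nonneg)
    also have "\<dots> \<le> (LINT x|lborel. ?N * normal_density 0 (1 / (2 * pi * k)) x)"
    proof (rule Bochner_Integration.integral_norm_bound_integral[OF integrable_mult_gauss_ft])
      show "norm (?C x * gauss_ft k (0 + x)) \<le> ?N * normal_density 0 (1 / (2 * pi * k)) x" for x
        using mult_right_mono[OF norm_corr_le[OF u2 L2_cnj[OF u2], of x], of "cmod (gauss_ft k x)"]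
        by (simp add: norm_mult norm_gauss_ft)
    qed (use k iC in auto)
    also have "\<dots> = ?N"
      using k by simp
    finally have "(LINT t|lborel. (cmod (ft u t))\<^sup>2 * cmod (gauss k t)) \<le> ?N" .
    then show ?thesis
      using i by (subst nn_integral_eq_integral) (auto simp: k_def intro: ennreal_leI)
  qed
  have "(\<integral>\<^sup>+t. ennreal ((cmod (ft u t))\<^sup>2) \<partial>lborel)
      = (\<integral>\<^sup>+t. liminf (\<lambda>n. ennreal ((cmod (ft u t))\<^sup>2 * cmod (gauss (Suc n) t))) \<partial>lborel)"
  proof (intro nn_integral_cong)
    fix t
    have "(\<lambda>n. (cmod (ft u t))\<^sup>2 * cmod (gauss (Suc n) t)) \<longlonglongrightarrow> (cmod (ft u t))\<^sup>2 * cmod 1"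
      by (intro tendsto_intros gauss_tendsto)
    then have "(\<lambda>n. ennreal ((cmod (ft u t))\<^sup>2 * cmod (gauss (Suc n) t))) \<longlonglongrightarrow> ennreal ((cmod (ft u t))\<^sup>2)"
      by (intro tendsto_ennrealI) simp
    then show "ennreal ((cmod (ft u t))\<^sup>2) = liminf (\<lambda>n. ennreal ((cmod (ft u t))\<^sup>2 * cmod (gauss (Suc n) t)))"
      by (intro lim_imp_Liminf[symmetric]) auto
  qed
  also have "\<dots> \<le> liminf (\<lambda>n. \<integral>\<^sup>+t. ennreal ((cmod (ft u t))\<^sup>2 * cmod (gauss (Suc n) t)) \<partial>lborel)"
    by (rule nn_integral_liminf) measurable
  also have "\<dots> \<le> ennreal ?N"
    using bound by (intro Liminf_le) auto
  also have "\<dots> < \<infinity>"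
    by simp
  finally have "integrable lborel (\<lambda>t. (cmod (ft u t))\<^sup>2)"
    by (intro integrableI_bounded) auto
  then show ?thesis
    by (simp add: L2_iff)
qed

subsection \<open>Band-limited functions and the ambiguity function\<close>

text \<open>Extending the density by 0 outside the band turns set integrals into integrals over the
  line. Its integrability comes from multiplying by the square-integrable indicator of the
  band.\<close>

lemma PW_obtain:
  assumes "f \<in> PW B"
  obtains F where "integrable lborel F" "L2 F" "\<And>\<xi>. \<bar>\<xi>\<bar> > B \<Longrightarrow> F \<xi> = 0"
    "\<And>z. f z = (LINT \<xi>|lborel. F \<xi> * exp (2 * pi * \<i> * complex_of_real \<xi> * z))"
proof -
  obtain G where G: "L2_on {-B..B} G"
    and f: "\<And>z. f z = (LINT \<xi>:{-B..B}|lborel. G \<xi> * exp (2 * pi * \<i> * complex_of_real \<xi> * z))"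
    using assms by (auto simp: PW_def)
  define F where "F \<xi> = indicator {-B..B} \<xi> *\<^sub>R G \<xi>" for \<xi>
  have [measurable]: "F \<in> borel_measurable borel"
    using G by (simp add: L2_on_def F_def[abs_def] borel_measurable_restrict_space_iff)
  have "integrable lborel (\<lambda>t. indicator {-B..B} t *\<^sub>R (cmod (G t))\<^sup>2)"
    using G by (simp add: L2_on_def integrable_restrict_space set_integrable_def)
  then have i: "integrable lborel (\<lambda>t. (cmod (F t))\<^sup>2)"
    by (rule Bochner_Integration.integrable_cong[THEN iffD1, rotated -1])
       (auto simp: F_def indicator_def)
  then have L2: "L2 F"
    by (simp add: L2_iff)
  have L2': "L2 (indicator {-B..B})"
  proof -
    have "(\<lambda>t. (cmod (indicator {-B..B} t))\<^sup>2) = indicat_real {-B..B}"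
      by (auto simp: indicator_def)
    then show ?thesis
      using integrable_real_indicator[of "{-B..B}" lborel] by (simp add: L2_iff emeasure_lborel_Icc_eq)
  qed
  have "integrable lborel (\<lambda>t. F t * indicator {-B..B} t)"
    by (rule integrable_L2_mult[OF L2 L2'])
  also have "(\<lambda>t. F t * indicator {-B..B} t) = F"
    by (auto simp: F_def indicator_def)
  finally have "integrable lborel F" .
  moreover have "f z = (LINT \<xi>|lborel. F \<xi> * exp (2 * pi * \<i> * complex_of_real \<xi> * z))" for z
    by (simp add: f set_lebesgue_integral_def F_def)
  ultimately show ?thesis
    using L2 by (intro that[of F]) (simp_all add: F_def indicator_def abs_if split: if_splits)
qed

text \<open>Expand the exponential and integrate term by term: on the support |\<xi>| is at most
  \<open>B\<close>, so the terms are dominated by |F| times the series of an exponential in |z|. The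
  resulting power series converges everywhere.\<close>

lemma bandlimited_holomorphic:
  fixes F :: "real \<Rightarrow> complex"
  assumes F: "integrable lborel F" and supp: "\<And>\<xi>. \<bar>\<xi>\<bar> > B \<Longrightarrow> F \<xi> = 0"
  shows "(\<lambda>z. LINT \<xi>|lborel. F \<xi> * exp (2 * pi * \<i> * complex_of_real \<xi> * z)) holomorphic_on UNIV"
    (is "?f holomorphic_on UNIV")
proof -
  have [measurable]: "F \<in> borel_measurable borel"
    using borel_measurable_integrable[OF F] by simp
  \<comment> \<open>The maximum keeps the majorant nonnegative for negative \<open>B\<close> as
    well.\<close>
  define B' where "B' = 2 * pi * max B 0"
  define a where "a n = (LINT \<xi>|lborel. F \<xi> * ((2 * pi * \<i> * \<xi>) ^ n / fact n))" for n
  have sums: "(\<lambda>n. a n * (z - 0) ^ n) sums ?f z" for z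
  proof -
    define g where "g n \<xi> = F \<xi> * ((2 * pi * \<i> * \<xi> * z) ^ n / fact n)" for n \<xi>
    have g_le: "norm (g n \<xi>) \<le> norm (F \<xi>) * ((B' * cmod z) ^ n / fact n)" for n \<xi>
    proof (cases "\<bar>\<xi>\<bar> > B")
      case False
      have "(2 * pi * \<bar>\<xi>\<bar> * cmod z) ^ n \<le> (B' * cmod z) ^ n"
        using False by (intro power_mono mult_right_mono) (auto simp: B'_def)
      then show ?thesis
        by (simp add: g_def norm_mult norm_divide norm_power divide_right_mono mult_left_mono)
    qed (simp add: g_def supp)
    have exp_sums: "(\<lambda>n. (B' * cmod z) ^ n / fact n) sums exp (B' * cmod z)"
      using exp_converges[of "B' * cmod z"] by (simp add: divide_inverse mult.commute)
    have g_meas [measurable]: "g n \<in> borel_measurable borel" for n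
      unfolding g_def by measurable
    have g_int: "integrable lborel (g n)" for n
    proof (rule Bochner_Integration.integrable_bound[where f = "\<lambda>\<xi>. norm (F \<xi>) * ((B' * cmod z) ^ n / fact n)"])
      show "AE \<xi> in lborel. norm (g n \<xi>) \<le> norm (norm (F \<xi>) * ((B' * cmod z) ^ n / fact n))"
        unfolding real_norm_def by (intro AE_I2 order_trans[OF g_le abs_ge_self])
    qed (use F in auto)
    have "(\<lambda>n. LINT \<xi>|lborel. g n \<xi>) sums (LINT \<xi>|lborel. (\<Sum>n. g n \<xi>))"
    proof (rule sums_integral[OF g_int])
      show "AE \<xi> in lborel. summable (\<lambda>n. norm (g n \<xi>))"
      proof (intro AE_I2)
        fix \<xi>
        show "summable (\<lambda>n. norm (g n \<xi>))"
          using g_le by (intro summable_comparison_test'[OF summable_mult[OF sums_summable[OF exp_sums], of "norm (F \<xi>)"], of 0]) auto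
      qed
      show "summable (\<lambda>n. LINT \<xi>|lborel. norm (g n \<xi>))"
      proof (intro summable_comparison_test'[OF summable_mult[OF sums_summable[OF exp_sums], of "LINT \<xi>|lborel. norm (F \<xi>)"], of 0])
        fix n
        have "(LINT \<xi>|lborel. norm (g n \<xi>)) \<le> (LINT \<xi>|lborel. norm (F \<xi>) * ((B' * cmod z) ^ n / fact n))"
          using g_int F g_le by (intro integral_mono) auto
        then show "norm (LINT \<xi>|lborel. norm (g n \<xi>)) \<le> (LINT \<xi>|lborel. norm (F \<xi>)) * ((B' * cmod z) ^ n / fact n)"
          by simp
      qed
    qed
    moreover have "(\<Sum>n. g n \<xi>) = F \<xi> * exp (2 * pi * \<i> * complex_of_real \<xi> * z)" for \<xi>
    proof -
      have "(\<lambda>n. (2 * pi * \<i> * \<xi> * z) ^ n / fact n) sums exp (2 * pi * \<i> * \<xi> * z)"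
        using exp_converges[of "2 * pi * \<i> * \<xi> * z"] by (simp add: scaleR_conv_of_real divide_inverse mult.commute)
      from sums_unique[OF sums_mult[OF this, of "F \<xi>"]] show ?thesis
        by (simp add: g_def)
    qed
    moreover have "(LINT \<xi>|lborel. g n \<xi>) = a n * (z - 0) ^ n" for n
    proof -
      have "(LINT \<xi>|lborel. g n \<xi>) = (LINT \<xi>|lborel. F \<xi> * ((2 * pi * \<i> * \<xi>) ^ n / fact n) * z ^ n)"
        unfolding g_def by (intro Bochner_Integration.integral_cong refl) (simp add: power_mult_distrib)
      then show ?thesis
        by (simp add: a_def)
    qed
    ultimately show ?thesis
      by simp
  qed
  have "?f holomorphic_on ball 0 r" for r
    by (rule power_series_holomorphic[of 0 r a]) (rule sums)
  then have "?f field_differentiable at z" for z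
    by (rule holomorphic_on_imp_differentiable_at[of _ "ball 0 (norm z + 1)"]) auto
  then show ?thesis
    by (simp add: holomorphic_on_def field_differentiable_at_within)
qed

section \<open>Lag products of band-limited functions\<close>

lemma exp_eq_cis: "exp (2 * pi * \<i> * complex_of_real \<xi> * complex_of_real t) = cis (2 * pi * \<xi> * t)"
  by (simp add: cis_conv_exp mult_ac)

text \<open>Up to a phase, the ambiguity function of \<open>u\<close> at \<open>(s, \<omega>)\<close> is \<open>ft (tensor u s) (- \<omega>)\<close>.\<close>

definition tensor :: "(real \<Rightarrow> complex) \<Rightarrow> real \<Rightarrow> real \<Rightarrow> complex" where
  "tensor u s t = u t * cnj (u (t - s))"

lemma integrable_tensor: "L2 u \<Longrightarrow> integrable lborel (tensor u s)"
  unfolding tensor_def by (intro integrable_L2_mult L2_cnj L2_translate)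

lemma STFT_eq_ft: "STFT \<phi> u x \<omega> = ft (\<lambda>t. u t * cnj (\<phi> (t - x))) (- \<omega>)"
  unfolding STFT_def ft_def
  by (intro Bochner_Integration.integral_cong refl) (simp add: cis_conv_exp mult_ac)

text \<open>The lag product of \<open>ft F\<close> is itself a transform, namely of the correlation
  of \<open>F\<close> with a modulated copy of \<open>F\<close>. Beyond 2B the shifted supports no
  longer overlap, so that correlation vanishes and \<open>ft_ft_support\<close> applies.\<close>

lemma tensor_ft_support:
  assumes F: "integrable lborel F" "L2 F" and supp: "\<And>\<xi>. \<bar>\<xi>\<bar> > B \<Longrightarrow> F \<xi> = 0"
    and \<omega>: "\<bar>\<omega>\<bar> > 2 * B"
  shows "ft (tensor (ft F) s) \<omega> = 0"
proof -
  \<comment> \<open>Modulation by \<open>- s\<close> translates the transform by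
    \<open>s\<close>.\<close>
  define H where "H = (\<lambda>\<eta>. F \<eta> * cis (2 * pi * \<eta> * (- s)))"
  have H: "integrable lborel H"
    unfolding H_def by (rule integrable_mult_cis[OF F(1)])
  have ftH: "ft H t = ft F (t - s)" for t
    unfolding H_def ft_modulate by simp
  let ?C = "corr F (\<lambda>t. cnj (H t))"
  have eq: "ft ?C = tensor (ft F) s"
    by (rule ext) (simp add: ft_corr_cnj F H ftH tensor_def)
  have "ft (ft ?C) \<omega> = 0"
  proof (rule ft_ft_support[OF _ _ _ \<omega>])
    show "integrable lborel ?C"
      using F H by (intro integrable_corr) auto
    \<comment> \<open>Not automatic for the transform of an integrable function; here it is a
      product of two L2 functions, by \<open>L2_ft\<close>.\<close>
    show "integrable lborel (ft ?C)"
      unfolding eq by (intro integrable_tensor L2_ft F)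
    show "?C x = 0" if "2 * B < \<bar>x\<bar>" for x
    proof -
      have "F t * cnj (H (t - x)) = 0" for t
      proof (cases "\<bar>t\<bar> > B")
        case False
        then have "\<bar>t - x\<bar> > B" using that by linarith
        then show ?thesis by (simp add: H_def supp)
      qed (simp add: supp)
      then show ?thesis by (simp only: corr_def Bochner_Integration.integral_zero)
    qed
  qed
  then show ?thesis
    by (simp add: eq)
qed

text \<open>Transforms of integrable functions are continuous and bounded, which turns uniqueness
  into equality at every point; the final argument evaluates lag products at single points.\<close>

lemma tensor_ft_inject:
  assumes F: "integrable lborel F" "L2 F" and G: "integrable lborel G" "L2 G"
    and eq: "\<And>\<omega>. ft (tensor (ft F) s) \<omega> = ft (tensor (ft G) s) \<omega>"
  shows "tensor (ft F) s = tensor (ft G) s"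
proof -
  have cont: "continuous_on UNIV (tensor (ft K) s)" if "integrable lborel K" for K
    unfolding tensor_def
    by (intro continuous_intros continuous_ft[OF that] continuous_on_compose2[OF continuous_ft[OF that]]) auto
  have bound: "cmod (tensor (ft K) s t) \<le> (LINT t|lborel. cmod (K t)) * (LINT t|lborel. cmod (K t))" for K t
    unfolding tensor_def norm_mult complex_mod_cnj by (intro mult_mono norm_ft_le) auto
  show ?thesis
    by (rule ft_inject[OF integrable_tensor[OF L2_ft[OF F]] cont[OF F(1)] bound
          integrable_tensor[OF L2_ft[OF G]] cont[OF G(1)] bound eq])
qed

section \<open>From the spectrogram to the lag products\<close>

text \<open>Two transforms are used in turn: one in the lag at fixed \<open>x\<close>, undone by
  uniqueness, and one in \<open>x\<close> at fixed lag \<open>s\<close>. Boundedness of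
  \<open>u\<close> and \<open>v\<close> puts the windowed functions in L2, so their autocorrelations
  are continuous and agree at every point.\<close>

lemma spectrogram_eq_imp_tensor_ft_eq:
  assumes \<phi>: "L2 \<phi>"
    and u: "L2 u" "u \<in> borel_measurable borel" "\<And>t. cmod (u t) \<le> C"
    and v: "L2 v" "v \<in> borel_measurable borel" "\<And>t. cmod (v t) \<le> D"
    and eq: "\<And>x \<omega>. cmod (STFT \<phi> u x \<omega>) = cmod (STFT \<phi> v x \<omega>)"
  shows "ft (tensor u s) \<omega> * cnj (ft (tensor \<phi> s) \<omega>) = ft (tensor v s) \<omega> * cnj (ft (tensor \<phi> s) \<omega>)"
proof -
  define h where "h w x t = w t * cnj (\<phi> (t - x))" for w x and t :: real
  have hL1: "integrable lborel (h w x)" if "L2 w" for w x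
    unfolding h_def by (intro integrable_L2_mult L2_cnj L2_translate \<phi> that)
  have hL2: "L2 (h w x)" if "w \<in> borel_measurable borel" "\<And>t. cmod (w t) \<le> E" for w x E
    unfolding h_def by (intro L2_bounded_mult[OF L2_cnj[OF L2_translate[OF \<phi>]] that])
  have corr_eq: "corr (h u x) (\<lambda>t. cnj (h u x t)) = corr (h v x) (\<lambda>t. cnj (h v x t))" for x
  proof (rule ft_inject)
    fix \<omega>
    have "cmod (ft (h u x) \<omega>) = cmod (ft (h v x) \<omega>)"
      using eq[of x "- \<omega>"] by (simp add: STFT_eq_ft h_def[abs_def])
    then show "ft (corr (h u x) (\<lambda>t. cnj (h u x t))) \<omega> = ft (corr (h v x) (\<lambda>t. cnj (h v x t))) \<omega>"
      by (simp add: ft_corr_cnj hL1 u v complex_norm_square[symmetric])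
  next
    show "integrable lborel (corr (h u x) (\<lambda>t. cnj (h u x t)))"
      "integrable lborel (corr (h v x) (\<lambda>t. cnj (h v x t)))"
      using u v by (auto intro!: integrable_corr hL1)
  qed (use hL2[OF u(2,3)] hL2[OF v(2,3)] in \<open>auto intro: continuous_corr norm_corr_le L2_cnj\<close>)
  \<comment> \<open>The same four factors, grouped by function instead of by shift.\<close>
  have corr_tensor: "corr (h w x) (\<lambda>t. cnj (h w x t)) s = corr (tensor w s) (\<lambda>t. cnj (tensor \<phi> s t)) x" for w x
    unfolding corr_def h_def tensor_def by (simp add: mult_ac diff_diff_eq add.commute)
  have "corr (tensor u s) (\<lambda>t. cnj (tensor \<phi> s t)) = corr (tensor v s) (\<lambda>t. cnj (tensor \<phi> s t))"
    using corr_eq by (simp add: fun_eq_iff flip: corr_tensor)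
  then show ?thesis
    using ft_corr_cnj[OF integrable_tensor[OF u(1)] integrable_tensor[OF \<phi>]]
      ft_corr_cnj[OF integrable_tensor[OF v(1)] integrable_tensor[OF \<phi>]] by metis
qed

text \<open>Moving \<open>s\<close> away from 0 changes the transform by at most an L1 distance
  independent of \<omega>, which tends to 0. On the compact set the modulus at \<open>s = 0\<close>
  has a positive lower bound.\<close>

lemma tensor_ft_nonzero_near_0:
  assumes \<phi>: "L2 \<phi>" and K: "compact K" and nz: "\<And>\<omega>. \<omega> \<in> K \<Longrightarrow> ft (tensor \<phi> 0) \<omega> \<noteq> 0"
  obtains d where "d > 0" "\<And>s \<omega>. \<bar>s\<bar> < d \<Longrightarrow> \<omega> \<in> K \<Longrightarrow> ft (tensor \<phi> s) \<omega> \<noteq> 0"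
proof -
  obtain m where m: "m > 0" "\<And>\<omega>. \<omega> \<in> K \<Longrightarrow> m \<le> cmod (ft (tensor \<phi> 0) \<omega>)"
  proof (cases "K = {}")
    case False
    have "continuous_on K (\<lambda>\<omega>. cmod (ft (tensor \<phi> 0) \<omega>))"
      by (intro continuous_intros continuous_on_subset[OF continuous_ft[OF integrable_tensor[OF \<phi>]]]) auto
    from continuous_attains_inf[OF K False this] obtain x where
      "x \<in> K" "\<forall>y\<in>K. cmod (ft (tensor \<phi> 0) x) \<le> cmod (ft (tensor \<phi> 0) y)" by blast
    then show ?thesis
      using that[of "cmod (ft (tensor \<phi> 0) x)"] nz by auto
  qed (use that[of 1] in auto)
  let ?E = "\<lambda>s. LINT t|lborel. cmod (\<phi> t) * cmod (\<phi> (t - s) - \<phi> t)"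
  have "eventually (\<lambda>s. dist (?E s) 0 < m) (at 0)"
    using m by (intro tendstoD translate_L2_mult_tendsto \<phi>) auto
  \<comment> \<open>The limit at 0 leaves out the point 0 itself, so \<open>s = 0\<close> is settled
    separately by \<open>nz\<close>.\<close>
  then obtain d where d: "d > 0" "\<And>s. s \<noteq> 0 \<Longrightarrow> \<bar>s\<bar> < d \<Longrightarrow> ?E s < m"
    by (auto simp: eventually_at abs_less_iff)
  have "ft (tensor \<phi> s) \<omega> \<noteq> 0" if s: "\<bar>s\<bar> < d" and \<omega>: "\<omega> \<in> K" for s \<omega>
  proof (cases "s = 0")
    case False
    have "cmod (ft (tensor \<phi> s) \<omega> - ft (tensor \<phi> 0) \<omega>) = cmod (ft (\<lambda>t. tensor \<phi> s t - tensor \<phi> 0 t) \<omega>)"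
      by (simp add: ft_diff integrable_tensor \<phi>)
    also have "\<dots> \<le> (LINT t|lborel. cmod (tensor \<phi> s t - tensor \<phi> 0 t))"
      by (rule norm_ft_le)
    also have "\<dots> = ?E s"
    proof (intro Bochner_Integration.integral_cong refl)
      fix t
      have "tensor \<phi> s t - tensor \<phi> 0 t = \<phi> t * cnj (\<phi> (t - s) - \<phi> t)"
        by (simp add: tensor_def algebra_simps)
      then show "cmod (tensor \<phi> s t - tensor \<phi> 0 t) = cmod (\<phi> t) * cmod (\<phi> (t - s) - \<phi> t)"
        by (simp only: norm_mult complex_mod_cnj)
    qed
    also have "\<dots> < m"
      using d(2)[OF False s] .
    also have "m \<le> cmod (ft (tensor \<phi> 0) \<omega>)"
      by (rule m(2)[OF \<omega>])
    finally show ?thesis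
      by auto
  qed (use nz \<omega> in auto)
  then show ?thesis
    using that d(1) by blast
qed

section \<open>Recovering the function up to a phase\<close>

text \<open>Lag 0 gives equal moduli on the real line. From a real point where \<open>f\<close> is
  nonzero, the small lags give proportionality on an interval, and the identity theorem extends it
  to the plane.\<close>

lemma tensor_eq_imp_proportional:
  assumes f: "f holomorphic_on UNIV" and g: "g holomorphic_on UNIV" and "d > 0"
    and eq: "\<And>s t. \<bar>s\<bar> < d \<Longrightarrow>
      tensor (\<lambda>t. f (complex_of_real t)) s t = tensor (\<lambda>t. g (complex_of_real t)) s t"
  shows "\<exists>\<alpha>::real. f = (\<lambda>z. exp (\<i> * complex_of_real \<alpha>) * g z)"
proof -
  have norm_eq: "cmod (f (of_real t)) = cmod (g (of_real t))" for t
  proof -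
    have "f (of_real t) * cnj (f (of_real t)) = g (of_real t) * cnj (g (of_real t))"
      using eq[of 0 t] \<open>d > 0\<close> by (simp add: tensor_def)
    then have "complex_of_real ((cmod (f (of_real t)))\<^sup>2) = complex_of_real ((cmod (g (of_real t)))\<^sup>2)"
      by (simp only: complex_norm_square)
    then show ?thesis
      by (simp only: of_real_eq_iff power2_eq_iff_nonneg norm_ge_zero)
  qed
  \<comment> \<open>Zeros filling a real interval about \<open>t\<close> accumulate at
    \<open>t\<close>, as the identity theorem demands.\<close>
  have ident: "h z = 0" if h: "h holomorphic_on UNIV" and h0: "\<And>s. \<bar>s\<bar> < d \<Longrightarrow> h (of_real (t - s)) = 0"
    for h :: "complex \<Rightarrow> complex" and t :: real and z
  proof (rule analytic_continuation[OF h open_UNIV connected_UNIV])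
    let ?U = "(\<lambda>s. complex_of_real (t - s)) ` {s. \<bar>s\<bar> < d}"
    show "h z = 0" if "z \<in> ?U" for z
      using that h0 by auto
    show "complex_of_real t islimpt ?U"
      unfolding islimpt_approachable
    proof (intro allI impI)
      fix e :: real
      assume e: "e > 0"
      define s where "s = min (e / 2) (d / 2)"
      have s: "s > 0" "\<bar>s\<bar> < d" "s < e"
        using e \<open>d > 0\<close> by (auto simp: s_def)
      show "\<exists>x'\<in>?U. x' \<noteq> complex_of_real t \<and> dist x' (complex_of_real t) < e"
      proof (intro bexI conjI)
        show "complex_of_real (t - s) \<in> ?U"
          using s by auto
      qed (use s in \<open>auto simp: dist_norm\<close>)
    qed
  qed auto
  show ?thesis
  \<comment> \<open>If \<open>f\<close> vanishes on the real line, so does \<open>g\<close>, and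
    both are 0 everywhere; any phase serves, and 0 is taken.\<close>
  proof (cases "\<forall>t::real. f (of_real t) = 0")
    case True
    have "f z = 0" for z
      by (rule ident[OF f, where t = 0]) (simp only: True)
    moreover have "g z = 0" for z
      by (rule ident[OF g, where t = 0]) (metis True norm_eq norm_eq_zero)
    ultimately have "f = (\<lambda>z. exp (\<i> * complex_of_real 0) * g z)"
      by (simp add: fun_eq_iff)
    then show ?thesis ..
  next
    case False
    then obtain t :: real where t: "f (of_real t) \<noteq> 0" by blast
    \<comment> \<open>Found by conjugating the equation of lag products at \<open>t\<close> and
      dividing by the conjugate of \<open>f\<close> at \<open>t\<close>. Equality of moduli at
      \<open>t\<close> makes it unimodular.\<close>
    define c where "c = cnj (g (of_real t) / f (of_real t))"
    have c: "cmod c = 1"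
      using t by (simp add: c_def norm_divide norm_eq[symmetric])
    have fg_near: "f (of_real (t - s)) - c * g (of_real (t - s)) = 0" if "\<bar>s\<bar> < d" for s
    proof -
      have "cnj (f (of_real t) * cnj (f (of_real (t - s)))) = cnj (g (of_real t) * cnj (g (of_real (t - s))))"
        using eq[OF that, of t] by (simp only: tensor_def)
      then show ?thesis
        using t by (simp add: c_def field_simps)
    qed
    have "f z - c * g z = 0" for z
      by (rule ident[where h = "\<lambda>z. f z - c * g z", OF _ fg_near]) (intro holomorphic_intros f g)
    then have "f = (\<lambda>z. c * g z)"
      by auto
    moreover have "c = exp (\<i> * complex_of_real (Arg c))"
      using Arg_eq[of c] c by fastforce
    ultimately show ?thesis
      by metis
  qed
qed

theorem theorem3p2:
  fixes B :: real and \<phi> :: "real \<Rightarrow> complex" and f g :: "complex \<Rightarrow> complex"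
  assumes "B > 0"
    and "L2 \<phi>"
    and "\<forall>\<omega>\<in>{-2*B..2*B}. ambiguity \<phi> 0 \<omega> \<noteq> 0"
    and "f \<in> PW B" and "g \<in> PW B"
  shows "(\<exists>\<alpha>::real. f = (\<lambda>z. exp (\<i> * complex_of_real \<alpha>) * g z)) \<longleftrightarrow>
         (\<forall>x \<omega>. cmod (STFT \<phi> (\<lambda>t. f (complex_of_real t)) x \<omega>)
              = cmod (STFT \<phi> (\<lambda>t. g (complex_of_real t)) x \<omega>))"
proof (intro iffI allI)
  fix x \<omega>
  assume "\<exists>\<alpha>::real. f = (\<lambda>z. exp (\<i> * complex_of_real \<alpha>) * g z)"
  then obtain \<alpha> :: real where "f = (\<lambda>z. exp (\<i> * complex_of_real \<alpha>) * g z)" by blast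
  then have "STFT \<phi> (\<lambda>t. f (complex_of_real t)) x \<omega>
      = exp (\<i> * complex_of_real \<alpha>) * STFT \<phi> (\<lambda>t. g (complex_of_real t)) x \<omega>"
    by (simp add: STFT_def mult.assoc)
  then show "cmod (STFT \<phi> (\<lambda>t. f (complex_of_real t)) x \<omega>) = cmod (STFT \<phi> (\<lambda>t. g (complex_of_real t)) x \<omega>)"
    by (simp add: norm_mult)
next
  assume eq: "\<forall>x \<omega>. cmod (STFT \<phi> (\<lambda>t. f (complex_of_real t)) x \<omega>)
      = cmod (STFT \<phi> (\<lambda>t. g (complex_of_real t)) x \<omega>)"
  obtain F where F: "integrable lborel F" "L2 F" "\<And>\<xi>. \<bar>\<xi>\<bar> > B \<Longrightarrow> F \<xi> = 0"
    and f: "\<And>z. f z = (LINT \<xi>|lborel. F \<xi> * exp (2 * pi * \<i> * complex_of_real \<xi> * z))"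
    using PW_obtain[OF \<open>f \<in> PW B\<close>] by blast
  obtain G where G: "integrable lborel G" "L2 G" "\<And>\<xi>. \<bar>\<xi>\<bar> > B \<Longrightarrow> G \<xi> = 0"
    and g: "\<And>z. g z = (LINT \<xi>|lborel. G \<xi> * exp (2 * pi * \<i> * complex_of_real \<xi> * z))"
    using PW_obtain[OF \<open>g \<in> PW B\<close>] by blast
  have ft: "(\<lambda>t. f (complex_of_real t)) = ft F" "(\<lambda>t. g (complex_of_real t)) = ft G"
    by (simp_all only: fun_eq_iff f g ft_def exp_eq_cis simp_thms)
  have "ft (tensor \<phi> 0) \<omega> \<noteq> 0" if "\<omega> \<in> {-2*B..2*B}" for \<omega>
  proof -
    \<comment> \<open>The phase factor is 1 at \<open>x = 0\<close>, and the sign change in \<omega>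
      is harmless on a symmetric interval.\<close>
    have "ambiguity \<phi> 0 (- \<omega>) = ft (tensor \<phi> 0) \<omega>"
      by (simp add: ambiguity_def STFT_eq_ft tensor_def[abs_def])
    then show ?thesis
      using assms(3) that by (metis atLeastAtMost_iff minus_le_iff mult_minus_left neg_le_iff_le)
  qed
  from tensor_ft_nonzero_near_0[OF \<open>L2 \<phi>\<close> compact_Icc this] obtain d where d: "d > 0"
    and nz: "\<And>s \<omega>. \<bar>s\<bar> < d \<Longrightarrow> \<omega> \<in> {-2*B..2*B} \<Longrightarrow> ft (tensor \<phi> s) \<omega> \<noteq> 0"
    by blast
  have "tensor (ft F) s = tensor (ft G) s" if s: "\<bar>s\<bar> < d" for s
  proof (rule tensor_ft_inject[OF F(1,2) G(1,2)])
    fix \<omega>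
    show "ft (tensor (ft F) s) \<omega> = ft (tensor (ft G) s) \<omega>"
    \<comment> \<open>Outside the doubled band both transforms vanish; inside, the common factor
      coming from the window is nonzero at this lag and cancels.\<close>
    proof (cases "\<bar>\<omega>\<bar> > 2 * B")
      case True
      then show ?thesis
        using tensor_ft_support[OF F] tensor_ft_support[OF G] by simp
    next
      case False
      then have "ft (tensor \<phi> s) \<omega> \<noteq> 0"
        by (intro nz s) auto
      moreover have "ft (tensor (ft F) s) \<omega> * cnj (ft (tensor \<phi> s) \<omega>)
          = ft (tensor (ft G) s) \<omega> * cnj (ft (tensor \<phi> s) \<omega>)"
        using eq unfolding ft
        by (intro spectrogram_eq_imp_tensor_ft_eq[OF \<open>L2 \<phi>\<close> L2_ft[OF F(1,2)] borel_measurable_ft[OF F(1)] norm_ft_le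
              L2_ft[OF G(1,2)] borel_measurable_ft[OF G(1)] norm_ft_le]) auto
      ultimately show ?thesis
        by simp
    qed
  qed
  moreover have "f holomorphic_on UNIV" "g holomorphic_on UNIV"
    using bandlimited_holomorphic[of F B, OF F(1,3)] bandlimited_holomorphic[of G B, OF G(1,3)]
    by (simp_all only: ext[of f, OF f] ext[of g, OF g])
  ultimately show "\<exists>\<alpha>::real. f = (\<lambda>z. exp (\<i> * complex_of_real \<alpha>) * g z)"
    using d by (intro tensor_eq_imp_proportional[of f g d]) (simp_all only: ft)
qed

end
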